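(* The AMA-Dirac element $\mathcal{D}=\sum_{i<j}M_{ij}\otimes c_ic_j\in\mathsf{A}\otimes\mathcal{C}$ satisfies $$\mathcal{D}^2=-\mathbf{M}^2+(n-2)\mathcal{D}+\{\mathcal{D},Z\},$$ where $\mathbf{M}^2=\sum_{i<j}M_{ij}^2$, $Z=\sum_{\alpha>0}c_\alpha s_\alpha\in\mathbb{C}W$ and $\{a,b\}=ab+ba$.
   Context: Setting. $(E,B)$ is a Euclidean space of dimension $n$ affording the reflection representation of a finite (real) reflection group $W\subset\mathsf{O}(E,B)$. $R\subset E^*$ is the root system, $R^\vee\subset E$ the dual root system with $\langle\alpha,\alpha^\vee\rangle=2$, where $\langle-,-\rangle\colon E^*\times E\to\mathbb{R}$ is the natural pairing; $s_\alpha(y)=y-\langle\alpha,y\rangle\alpha^\vee$. A positive system $R_+$ is fixed, and $c\colon R_+\to\mathbb{C}$, $\alpha\mapsto c_\alpha$, is a $W$-invariant parameter function. Put $\mathfrak{h}=E_{\mathbb{C}}$, $\mathfrak{h}^*=E^*_{\mathbb{C}}$. Fix an orthonormal basis $y_1,\dots,y_n$ of $E$ and let $x_1,\dots,x_n$ be the dual basis of $E^*$. Rational Cherednik algebra $\mathsf{H}$: the quotient of the smash product $T(\mathfrak{h}^*\oplus\mathfrak{h})\#W$ by $[x,x']=0=[y,y']$ and $[y,x]=\langle x,y\rangle+\sum_{\alpha>0}c_\alpha\langle\alpha,y\rangle\langle x,\alpha^\vee\rangle s_\alpha$ for $x,x'\in\mathfrak{h}^*$, $y,y'\in\mathfrak{h}$.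 Dunkl angular momentum algebra $\mathsf{A}$: the associative subalgebra of $\mathsf{H}$ generated by $W$ and the elements $M_{ij}=x_iy_j-x_jy_i$, $1\le i<j\le n$. $\mathcal{C}$ is the complex Clifford algebra with generators $c_1,\dots,c_n$ and relations $c_ic_j+c_jc_i=2\delta_{ij}$. Elements $a\in\mathsf{A}$ are identified with $a\otimes1\in\mathsf{A}\otimes\mathcal{C}$. *)

theory Defs
  imports
    "HOL-Analysis.Analysis"
    "HOL-Library.Poly_Mapping"
    "HOL-Algebra.QuotRing"
    "HOL-Algebra.Module"
    "HOL-Algebra.Generated_Groups"
    "HOL-Algebra.Generated_Rings"
begin

section \<open>Complex algebras, quotients and tensor products\<close>

text \<open>
  A complex associative unital algebra is presented as a record of type \<open>(complex, 'a) module\<close>: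
  the ring operations together with scalar multiplication \<open>\<odot>\<close>. (The locale \<open>algebra\<close>
  of HOL-Algebra only covers commutative algebras and is not used.)
\<close>

text \<open>The monoid algebra \<open>\<complex>[G]\<close>; the basis vector of a monoid element \<open>g\<close>
  is \<open>Poly_Mapping.single g 1\<close>.\<close>

definition monoid_alg :: "('g, 'm) monoid_scheme \<Rightarrow> (complex, 'g \<Rightarrow>\<^sub>0 complex) module" where
  "monoid_alg G =
    \<lparr>carrier = {p. Poly_Mapping.keys p \<subseteq> carrier G},
     mult = (\<lambda>p q. \<Sum>g\<in>Poly_Mapping.keys p. \<Sum>h\<in>Poly_Mapping.keys q.
        Poly_Mapping.single (g \<otimes>\<^bsub>G\<^esub> h) (Poly_Mapping.lookup p g * Poly_Mapping.lookup q h)),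
     one = Poly_Mapping.single \<one>\<^bsub>G\<^esub> 1,
     zero = 0,
     add = (+),
     smult = (\<lambda>z p. Poly_Mapping.map ((*) z) p)\<rparr>"

text \<open>\<open>quot_alg A S\<close> is the quotient of \<open>A\<close> by the two-sided ideal generated by \<open>S\<close>,
  and \<open>quot_proj A S\<close> is the projection onto it. Since \<open>A\<close> is unital over \<open>\<complex>\<close>,
  two-sided ring ideals are closed under scalars.\<close>

definition quot_proj :: "(complex, 'a) module \<Rightarrow> 'a set \<Rightarrow> 'a \<Rightarrow> 'a set" where
  "quot_proj A S a = (Idl\<^bsub>A\<^esub> S) +>\<^bsub>A\<^esub> a"

definition quot_alg :: "(complex, 'a) module \<Rightarrow> 'a set \<Rightarrow> (complex, 'a set) module" where
  "quot_alg A S =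
    (let Q = A Quot (Idl\<^bsub>A\<^esub> S) in
     \<lparr>carrier = carrier Q, mult = mult Q, one = one Q, zero = zero Q, add = add Q,
      smult = (\<lambda>z X. \<Union>a\<in>X. quot_proj A S (z \<odot>\<^bsub>A\<^esub> a))\<rparr>)"

definition subalgebra_generated :: "(complex, 'a) module \<Rightarrow> 'a set \<Rightarrow> (complex, 'a) module" where
  "subalgebra_generated A S =
    A\<lparr>carrier := generate_ring A (range (\<lambda>z. z \<odot>\<^bsub>A\<^esub> \<one>\<^bsub>A\<^esub>) \<union> S)\<rparr>"

text \<open>The tensor product \<open>A \<otimes> B\<close> over \<open>\<complex>\<close>: the free vector space on pairs
  \<open>(a, b)\<close>, with product \<open>(a, b) (a', b') = (a a', b b')\<close>, modulo bilinearity.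
  The subspace spanned by the bilinearity relations is already a two-sided ideal.\<close>

definition bilin_rels ::
    "(complex, 'a) module \<Rightarrow> (complex, 'b) module \<Rightarrow> ('a \<times> 'b \<Rightarrow>\<^sub>0 complex) set" where
  "bilin_rels A B =
     {Poly_Mapping.single (a \<oplus>\<^bsub>A\<^esub> a', b) 1 - Poly_Mapping.single (a, b) 1
        - Poly_Mapping.single (a', b) 1 | a a' b.
        a \<in> carrier A \<and> a' \<in> carrier A \<and> b \<in> carrier B} \<union>
     {Poly_Mapping.single (a, b \<oplus>\<^bsub>B\<^esub> b') 1 - Poly_Mapping.single (a, b) 1
        - Poly_Mapping.single (a, b') 1 | a b b'.
        a \<in> carrier A \<and> b \<in> carrier B \<and> b' \<in> carrier B} \<union>
     {Poly_Mapping.single (z \<odot>\<^bsub>A\<^esub> a, b) 1 - Poly_Mapping.single (a, b) z | z a b.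
        a \<in> carrier A \<and> b \<in> carrier B} \<union>
     {Poly_Mapping.single (a, z \<odot>\<^bsub>B\<^esub> b) 1 - Poly_Mapping.single (a, b) z | z a b.
        a \<in> carrier A \<and> b \<in> carrier B}"

definition tensor_alg ::
    "(complex, 'a) module \<Rightarrow> (complex, 'b) module \<Rightarrow> (complex, ('a \<times> 'b \<Rightarrow>\<^sub>0 complex) set) module" where
  "tensor_alg A B = quot_alg (monoid_alg (A \<times>\<times> B)) (bilin_rels A B)"

definition pure_tensor ::
    "(complex, 'a) module \<Rightarrow> (complex, 'b) module \<Rightarrow> 'a \<Rightarrow> 'b \<Rightarrow> ('a \<times> 'b \<Rightarrow>\<^sub>0 complex) set" where
  "pure_tensor A B a b =
     quot_proj (monoid_alg (A \<times>\<times> B)) (bilin_rels A B) (Poly_Mapping.single (a, b) 1)"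

definition commutator :: "('a, 'm) ring_scheme \<Rightarrow> 'a \<Rightarrow> 'a \<Rightarrow> 'a" where
  "commutator A a b = a \<otimes>\<^bsub>A\<^esub> b \<ominus>\<^bsub>A\<^esub> b \<otimes>\<^bsub>A\<^esub> a"

definition anticommutator :: "('a, 'm) ring_scheme \<Rightarrow> 'a \<Rightarrow> 'a \<Rightarrow> 'a" where
  "anticommutator A a b = a \<otimes>\<^bsub>A\<^esub> b \<oplus>\<^bsub>A\<^esub> b \<otimes>\<^bsub>A\<^esub> a"


section \<open>The Clifford algebra on \<open>c\<^sub>1, \<dots>, c\<^sub>n\<close>\<close>

definition free_monoid :: "'g set \<Rightarrow> 'g list monoid" where
  "free_monoid G = \<lparr>carrier = lists G, mult = (@), one = []\<rparr>"

definition clifford_rels :: "nat \<Rightarrow> (nat list \<Rightarrow>\<^sub>0 complex) set" where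
  "clifford_rels n =
     {Poly_Mapping.single [i, j] 1 + Poly_Mapping.single [j, i] 1
        - Poly_Mapping.single [] (if i = j then 2 else 0) | i j. i \<in> {1..n} \<and> j \<in> {1..n}}"

definition clifford :: "nat \<Rightarrow> (complex, (nat list \<Rightarrow>\<^sub>0 complex) set) module" where
  "clifford n = quot_alg (monoid_alg (free_monoid {1..n})) (clifford_rels n)"

definition cliff_gen :: "nat \<Rightarrow> nat \<Rightarrow> (nat list \<Rightarrow>\<^sub>0 complex) set" where
  "cliff_gen n i =
     quot_proj (monoid_alg (free_monoid {1..n})) (clifford_rels n) (Poly_Mapping.single [i] 1)"


section \<open>Reflection groups and root systems\<close>

text \<open>The Euclidean space \<open>(E, B)\<close> is a type of class \<open>euclidean_space\<close> with its
  inner product; the pairing of \<open>\<alpha> \<in> E\<^sup>*\<close> with \<open>v \<in> E\<close> is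
  \<open>blinfun_apply \<alpha> v\<close> (all linear functionals are bounded in finite dimension).\<close>

type_synonym 'e dual = "'e \<Rightarrow>\<^sub>L real"

definition riesz :: "'e::euclidean_space dual \<Rightarrow> 'e" where
  "riesz \<alpha> = (\<Sum>b\<in>Basis. blinfun_apply \<alpha> b *\<^sub>R b)"

text \<open>\<open>\<alpha>\<^sup>\<or>\<close> is the unique vector with \<open>\<langle>\<alpha>, \<alpha>\<^sup>\<or>\<rangle> = 2\<close> for which
  \<open>s\<^sub>\<alpha>\<close> below is orthogonal.\<close>

definition coroot :: "'e::euclidean_space dual \<Rightarrow> 'e" where
  "coroot \<alpha> = (2 / (riesz \<alpha> \<bullet> riesz \<alpha>)) *\<^sub>R riesz \<alpha>"

definition root_refl :: "'e::euclidean_space dual \<Rightarrow> 'e \<Rightarrow> 'e" where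
  "root_refl \<alpha> y = y - blinfun_apply \<alpha> y *\<^sub>R coroot \<alpha>"

definition dual_act :: "('e::euclidean_space \<Rightarrow> 'e) \<Rightarrow> 'e dual \<Rightarrow> 'e dual" where
  "dual_act w \<alpha> = Blinfun (\<lambda>v. blinfun_apply \<alpha> (inv_into UNIV w v))"

text \<open>The roots need not span \<open>E\<^sup>*\<close>, and no crystallographic condition is imposed.\<close>

definition root_system :: "'e::euclidean_space dual set \<Rightarrow> bool" where
  "root_system R \<longleftrightarrow> finite R \<and> 0 \<notin> R \<and>
     (\<forall>\<alpha>\<in>R. R \<inter> range (\<lambda>t. t *\<^sub>R \<alpha>) = {\<alpha>, - \<alpha>}) \<and>
     (\<forall>\<alpha>\<in>R. dual_act (root_refl \<alpha>) ` R = R)"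

text \<open>Positive systems are cut out by a generic vector; this is the same as positivity for
  some total ordering of \<open>E\<^sup>*\<close>.\<close>

definition positive_system :: "'e::euclidean_space dual set \<Rightarrow> 'e dual set \<Rightarrow> bool" where
  "positive_system R P \<longleftrightarrow>
     (\<exists>v. (\<forall>\<alpha>\<in>R. blinfun_apply \<alpha> v \<noteq> 0) \<and> P = {\<alpha>\<in>R. blinfun_apply \<alpha> v > 0})"

definition orthogonal_group :: "('e::euclidean_space \<Rightarrow> 'e) monoid" where
  "orthogonal_group = \<lparr>carrier = {f. orthogonal_transformation f}, mult = (\<circ>), one = id\<rparr>"

definition reflection_group :: "('e::euclidean_space \<Rightarrow> 'e) set \<Rightarrow> 'e dual set \<Rightarrow> bool" where
  "reflection_group W R \<longleftrightarrow>
     finite W \<and> root_system R \<and> W = generate orthogonal_group (root_refl ` R)"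

text \<open>A parameter function on the positive roots is \<open>W\<close>-invariant if it is constant on
  the intersections of \<open>W\<close>-orbits with the positive system; its values elsewhere are irrelevant.\<close>

definition invariant_param ::
    "('e::euclidean_space \<Rightarrow> 'e) set \<Rightarrow> 'e dual set \<Rightarrow> ('e dual \<Rightarrow> complex) \<Rightarrow> bool" where
  "invariant_param W P c \<longleftrightarrow>
     (\<forall>w\<in>W. \<forall>\<alpha>\<in>P. dual_act w \<alpha> \<in> P \<longrightarrow> c (dual_act w \<alpha>) = c \<alpha>)"


section \<open>The space \<open>\<hh>\<^sup>* \<oplus> \<hh>\<close>\<close>

text \<open>The complexification of a real vector space consists of pairs \<open>(u, v)\<close>, read as
  \<open>u + \<i> v\<close>.\<close>

type_synonym 'v cplx = "'v \<times> 'v"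

definition cplx_of :: "'v::real_vector \<Rightarrow> 'v cplx" where
  "cplx_of v = (v, 0)"

definition cplx_scale :: "complex \<Rightarrow> 'v::real_vector cplx \<Rightarrow> 'v cplx" where
  "cplx_scale z = (\<lambda>(u, v). (Re z *\<^sub>R u - Im z *\<^sub>R v, Re z *\<^sub>R v + Im z *\<^sub>R u))"

definition cplx_pairing :: "'e::euclidean_space dual cplx \<Rightarrow> 'e cplx \<Rightarrow> complex" where
  "cplx_pairing = (\<lambda>(\<xi>, \<eta>) (u, v).
     Complex (blinfun_apply \<xi> u - blinfun_apply \<eta> v) (blinfun_apply \<xi> v + blinfun_apply \<eta> u))"

type_synonym 'e hh = "'e dual cplx \<times> 'e cplx"

definition hh_scale :: "complex \<Rightarrow> 'e::euclidean_space hh \<Rightarrow> 'e hh" where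
  "hh_scale z = map_prod (cplx_scale z) (cplx_scale z)"

definition hh_act :: "('e::euclidean_space \<Rightarrow> 'e) \<Rightarrow> 'e hh \<Rightarrow> 'e hh" where
  "hh_act w = map_prod (map_prod (dual_act w) (dual_act w)) (map_prod w w)"


section \<open>The smash product \<open>T(\<hh>\<^sup>* \<oplus> \<hh>) # W\<close>\<close>

text \<open>A pair \<open>([v\<^sub>1, \<dots>, v\<^sub>k], w)\<close> stands for \<open>(v\<^sub>1 \<otimes> \<dots> \<otimes> v\<^sub>k) w\<close>, and the smash product rule
  \<open>(a w) (b w') = (a w(b)) (w w')\<close> is the product of a semidirect product of monoids. The smash
  product is the span of these symbols modulo multilinearity in the \<open>v\<^sub>i\<close>.\<close>

type_synonym 'e word = "'e hh list \<times> ('e \<Rightarrow> 'e)"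

definition smash_monoid :: "('e::euclidean_space \<Rightarrow> 'e) set \<Rightarrow> 'e word monoid" where
  "smash_monoid W =
    \<lparr>carrier = UNIV \<times> W,
     mult = (\<lambda>(us, w) (vs, w'). (us @ map (hh_act w) vs, w \<circ> w')),
     one = ([], id)\<rparr>"

definition multilin_rels :: "('e::euclidean_space word \<Rightarrow>\<^sub>0 complex) set" where
  "multilin_rels =
     {Poly_Mapping.single ([hh_scale z u + v], id) 1 - Poly_Mapping.single ([u], id) z
        - Poly_Mapping.single ([v], id) 1 | z u v. True}"

definition smash ::
    "('e::euclidean_space \<Rightarrow> 'e) set \<Rightarrow> (complex, ('e word \<Rightarrow>\<^sub>0 complex) set) module" where
  "smash W = quot_alg (monoid_alg (smash_monoid W)) multilin_rels"

definition smash_vec ::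
    "('e::euclidean_space \<Rightarrow> 'e) set \<Rightarrow> 'e hh \<Rightarrow> ('e word \<Rightarrow>\<^sub>0 complex) set" where
  "smash_vec W v =
     quot_proj (monoid_alg (smash_monoid W)) multilin_rels (Poly_Mapping.single ([v], id) 1)"

definition smash_grp ::
    "('e::euclidean_space \<Rightarrow> 'e) set \<Rightarrow> ('e \<Rightarrow> 'e) \<Rightarrow> ('e word \<Rightarrow>\<^sub>0 complex) set" where
  "smash_grp W w =
     quot_proj (monoid_alg (smash_monoid W)) multilin_rels (Poly_Mapping.single ([], w) 1)"


section \<open>The rational Cherednik algebra\<close>

definition cherednik_rels ::
    "('e::euclidean_space \<Rightarrow> 'e) set \<Rightarrow> 'e dual set \<Rightarrow> ('e dual \<Rightarrow> complex) \<Rightarrow>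
     ('e word \<Rightarrow>\<^sub>0 complex) set set" where
  "cherednik_rels W P c =
     {commutator (smash W) (smash_vec W (\<xi>, 0)) (smash_vec W (\<xi>', 0)) | \<xi> \<xi>'. True} \<union>
     {commutator (smash W) (smash_vec W (0, y)) (smash_vec W (0, y')) | y y'. True} \<union>
     {commutator (smash W) (smash_vec W (0, y)) (smash_vec W (\<xi>, 0)) \<ominus>\<^bsub>smash W\<^esub>
        (cplx_pairing \<xi> y \<odot>\<^bsub>smash W\<^esub> \<one>\<^bsub>smash W\<^esub> \<oplus>\<^bsub>smash W\<^esub>
         (\<Oplus>\<^bsub>smash W\<^esub>\<alpha>\<in>P.
            (c \<alpha> * cplx_pairing (cplx_of \<alpha>) y * cplx_pairing \<xi> (cplx_of (coroot \<alpha>)))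
              \<odot>\<^bsub>smash W\<^esub> smash_grp W (root_refl \<alpha>))) | \<xi> y. True}"

type_synonym 'e cherednik_elem = "('e word \<Rightarrow>\<^sub>0 complex) set set"

definition cherednik ::
    "('e::euclidean_space \<Rightarrow> 'e) set \<Rightarrow> 'e dual set \<Rightarrow> ('e dual \<Rightarrow> complex) \<Rightarrow>
     (complex, 'e cherednik_elem) module" where
  "cherednik W P c = quot_alg (smash W) (cherednik_rels W P c)"

definition ch_x ::
    "('e::euclidean_space \<Rightarrow> 'e) set \<Rightarrow> 'e dual set \<Rightarrow> ('e dual \<Rightarrow> complex) \<Rightarrow>
     'e dual cplx \<Rightarrow> 'e cherednik_elem" where
  "ch_x W P c \<xi> = quot_proj (smash W) (cherednik_rels W P c) (smash_vec W (\<xi>, 0))"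

definition ch_y ::
    "('e::euclidean_space \<Rightarrow> 'e) set \<Rightarrow> 'e dual set \<Rightarrow> ('e dual \<Rightarrow> complex) \<Rightarrow>
     'e cplx \<Rightarrow> 'e cherednik_elem" where
  "ch_y W P c v = quot_proj (smash W) (cherednik_rels W P c) (smash_vec W (0, v))"

definition ch_grp ::
    "('e::euclidean_space \<Rightarrow> 'e) set \<Rightarrow> 'e dual set \<Rightarrow> ('e dual \<Rightarrow> complex) \<Rightarrow>
     ('e \<Rightarrow> 'e) \<Rightarrow> 'e cherednik_elem" where
  "ch_grp W P c w = quot_proj (smash W) (cherednik_rels W P c) (smash_grp W w)"


section \<open>The Dunkl angular momentum algebra and the AMA-Dirac element\<close>

text \<open>Below, \<open>x\<close> and \<open>y\<close> are bases of \<open>E\<^sup>*\<close> and \<open>E\<close> indexed by \<open>{1..DIM('e)}\<close>.\<close>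

definition index_pairs :: "nat \<Rightarrow> (nat \<times> nat) set" where
  "index_pairs n = {(i, j). 1 \<le> i \<and> i < j \<and> j \<le> n}"

definition ang_mom ::
    "('e::euclidean_space \<Rightarrow> 'e) set \<Rightarrow> 'e dual set \<Rightarrow> ('e dual \<Rightarrow> complex) \<Rightarrow>
     (nat \<Rightarrow> 'e dual) \<Rightarrow> (nat \<Rightarrow> 'e) \<Rightarrow> nat \<Rightarrow> nat \<Rightarrow> 'e cherednik_elem" where
  "ang_mom W P c x y i j =
     ch_x W P c (cplx_of (x i)) \<otimes>\<^bsub>cherednik W P c\<^esub> ch_y W P c (cplx_of (y j))
     \<ominus>\<^bsub>cherednik W P c\<^esub>
     ch_x W P c (cplx_of (x j)) \<otimes>\<^bsub>cherednik W P c\<^esub> ch_y W P c (cplx_of (y i))"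

definition ama ::
    "('e::euclidean_space \<Rightarrow> 'e) set \<Rightarrow> 'e dual set \<Rightarrow> ('e dual \<Rightarrow> complex) \<Rightarrow>
     (nat \<Rightarrow> 'e dual) \<Rightarrow> (nat \<Rightarrow> 'e) \<Rightarrow> (complex, 'e cherednik_elem) module" where
  "ama W P c x y = subalgebra_generated (cherednik W P c)
     (ch_grp W P c ` W \<union> (\<lambda>(i, j). ang_mom W P c x y i j) ` index_pairs DIM('e))"

definition ama_M2 ::
    "('e::euclidean_space \<Rightarrow> 'e) set \<Rightarrow> 'e dual set \<Rightarrow> ('e dual \<Rightarrow> complex) \<Rightarrow>
     (nat \<Rightarrow> 'e dual) \<Rightarrow> (nat \<Rightarrow> 'e) \<Rightarrow> 'e cherednik_elem" where
  "ama_M2 W P c x y = finsum (ama W P c x y)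
     (\<lambda>(i, j). ang_mom W P c x y i j \<otimes>\<^bsub>ama W P c x y\<^esub> ang_mom W P c x y i j)
     (index_pairs DIM('e))"

definition ama_Z ::
    "('e::euclidean_space \<Rightarrow> 'e) set \<Rightarrow> 'e dual set \<Rightarrow> ('e dual \<Rightarrow> complex) \<Rightarrow>
     (nat \<Rightarrow> 'e dual) \<Rightarrow> (nat \<Rightarrow> 'e) \<Rightarrow> 'e cherednik_elem" where
  "ama_Z W P c x y =
     (\<Oplus>\<^bsub>ama W P c x y\<^esub>\<alpha>\<in>P. c \<alpha> \<odot>\<^bsub>ama W P c x y\<^esub> ch_grp W P c (root_refl \<alpha>))"

type_synonym 'e ama_cliff_elem =
  "('e cherednik_elem \<times> (nat list \<Rightarrow>\<^sub>0 complex) set \<Rightarrow>\<^sub>0 complex) set"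

definition ama_cliff ::
    "('e::euclidean_space \<Rightarrow> 'e) set \<Rightarrow> 'e dual set \<Rightarrow> ('e dual \<Rightarrow> complex) \<Rightarrow>
     (nat \<Rightarrow> 'e dual) \<Rightarrow> (nat \<Rightarrow> 'e) \<Rightarrow> (complex, 'e ama_cliff_elem) module" where
  "ama_cliff W P c x y = tensor_alg (ama W P c x y) (clifford DIM('e))"

text \<open>the identification of \<open>a\<close> with \<open>a \<otimes> 1\<close>\<close>

definition ama_incl ::
    "('e::euclidean_space \<Rightarrow> 'e) set \<Rightarrow> 'e dual set \<Rightarrow> ('e dual \<Rightarrow> complex) \<Rightarrow>
     (nat \<Rightarrow> 'e dual) \<Rightarrow> (nat \<Rightarrow> 'e) \<Rightarrow> 'e cherednik_elem \<Rightarrow> 'e ama_cliff_elem" where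
  "ama_incl W P c x y a =
     pure_tensor (ama W P c x y) (clifford DIM('e)) a \<one>\<^bsub>clifford DIM('e)\<^esub>"

definition ama_dirac ::
    "('e::euclidean_space \<Rightarrow> 'e) set \<Rightarrow> 'e dual set \<Rightarrow> ('e dual \<Rightarrow> complex) \<Rightarrow>
     (nat \<Rightarrow> 'e dual) \<Rightarrow> (nat \<Rightarrow> 'e) \<Rightarrow> 'e ama_cliff_elem" where
  "ama_dirac W P c x y = finsum (ama_cliff W P c x y)
     (\<lambda>(i, j). pure_tensor (ama W P c x y) (clifford DIM('e)) (ang_mom W P c x y i j)
        (cliff_gen DIM('e) i \<otimes>\<^bsub>clifford DIM('e)\<^esub> cliff_gen DIM('e) j))
     (index_pairs DIM('e))"

end

theory Submission
  imports Defs
begin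

text \<open>
  With \<open>S\<^sub>i\<^sub>j = [y\<^sub>i, x\<^sub>j]\<close>, which is symmetric in \<open>i, j\<close>, the angular momenta satisfy the crossing relation
  \<open>M\<^sub>i\<^sub>j M\<^sub>k\<^sub>l + M\<^sub>j\<^sub>k M\<^sub>i\<^sub>l + M\<^sub>k\<^sub>i M\<^sub>j\<^sub>l = M\<^sub>i\<^sub>j S\<^sub>k\<^sub>l + M\<^sub>j\<^sub>k S\<^sub>i\<^sub>l + M\<^sub>k\<^sub>i S\<^sub>j\<^sub>l\<close>.
  Multiplying by \<open>c\<^sub>i c\<^sub>j c\<^sub>k c\<^sub>l\<close>, summing over all indices and rotating \<open>i, j, k\<close> with the Clifford
  relations expresses \<open>4 \<D>\<^sup>2\<close> through sums over two Clifford generators; the case \<open>l = j\<close> of the crossing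
  relation evaluates the commutators \<open>[M\<^sub>i\<^sub>j, M\<^sub>j\<^sub>l]\<close> occurring there. The outcome is
  \<open>\<D>\<^sup>2 = - M\<^sup>2 + \<D> (\<Sum>\<^sub>k S\<^sub>k\<^sub>k) - K\<close> with \<open>K = \<Sum> M\<^sub>i\<^sub>j S\<^sub>j\<^sub>l c\<^sub>i c\<^sub>l\<close>. Since
  \<open>\<langle>\<alpha>, \<alpha>\<^sup>\<or>\<rangle> = 2\<close>, the trace of \<open>S\<close> is \<open>n + 2 Z\<close>, and conjugation of the
  \<open>M\<^sub>i\<^sub>j\<close> by reflections gives \<open>K = 2 \<D> + [\<D>, Z]\<close>.
\<close>

section \<open>Dunkl relations\<close>

text \<open>The crossing relation rests on the commutation rules of the x and y, which are elements
  of \<open>H\<close>; the identity to be proved lives over \<open>A\<close>, which is given by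
  \<open>W\<close> and the \<open>M i j\<close>. Hence two abstract computations:
  \<open>dunkl_relations\<close> eliminates \<open>X\<close> and \<open>Y\<close>, and
  \<open>ama_clifford_relations\<close> starts from what is left. Its input is verified in
  \<open>H\<close>, pulled back to \<open>A\<close>, whose operations are those of \<open>H\<close>,
  and pushed forward along a \<mapsto> a \<otimes> 1. Sums run over all indices rather than over i <
  j because the crossing relation is cyclic in three indices and the restriction i < j is not
  preserved by rotation. A rotation of three Clifford generators is an even permutation, so the
  three products on either side of the relation give the same quartic sum up to contractions, which
  have two generators left. The summand -2 in n - 2 goes back to the Kronecker delta in S, whose
  contraction with M is twice the Dirac element.\<close>

text \<open>\<open>s \<alpha>\<close> stands for \<open>c\<^sub>\<alpha> s\<^sub>\<alpha>\<close>, which absorbs the only non-real scalars, \<open>a \<alpha>\<close> and \<open>b \<alpha>\<close> are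
  the coordinates of \<open>\<alpha>\<close> and \<open>\<alpha>\<^sup>\<or>\<close>, and \<open>e\<close> is the image of the unit under a non-unital embedding.\<close>

locale dunkl_relations =
  fixes I :: "nat set" and P :: "'p set"
    and X Y :: "nat \<Rightarrow> 'r::real_algebra" and s :: "'p \<Rightarrow> 'r" and e :: 'r
    and a b :: "'p \<Rightarrow> nat \<Rightarrow> real"
  assumes XX: "\<And>i j. i \<in> I \<Longrightarrow> j \<in> I \<Longrightarrow> X i * X j = X j * X i"
    and YY: "\<And>i j. i \<in> I \<Longrightarrow> j \<in> I \<Longrightarrow> Y i * Y j = Y j * Y i"
    and YX: "\<And>i j. i \<in> I \<Longrightarrow> j \<in> I \<Longrightarrow>
      Y i * X j = X j * Y i + ((if i = j then e else 0) + (\<Sum>\<alpha>\<in>P. (a \<alpha> i * b \<alpha> j) *\<^sub>R s \<alpha>))"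
    and sX: "\<And>\<alpha> i. \<alpha> \<in> P \<Longrightarrow> i \<in> I \<Longrightarrow> s \<alpha> * X i = (X i - b \<alpha> i *\<^sub>R (\<Sum>m\<in>I. a \<alpha> m *\<^sub>R X m)) * s \<alpha>"
    and sY: "\<And>\<alpha> i. \<alpha> \<in> P \<Longrightarrow> i \<in> I \<Longrightarrow> s \<alpha> * Y i = (Y i - a \<alpha> i *\<^sub>R (\<Sum>m\<in>I. b \<alpha> m *\<^sub>R Y m)) * s \<alpha>"
    and ab: "\<And>\<alpha> i j. \<alpha> \<in> P \<Longrightarrow> i \<in> I \<Longrightarrow> j \<in> I \<Longrightarrow> a \<alpha> i * b \<alpha> j = a \<alpha> j * b \<alpha> i"
    and X_e: "\<And>i. i \<in> I \<Longrightarrow> X i * e = X i" and e_Y: "\<And>i. i \<in> I \<Longrightarrow> e * Y i = Y i"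
    and Y_e: "\<And>i. i \<in> I \<Longrightarrow> Y i * e = Y i"
begin

definition S :: "nat \<Rightarrow> nat \<Rightarrow> 'r" where
  "S i j = (if i = j then e else 0) + (\<Sum>\<alpha>\<in>P. (a \<alpha> i * b \<alpha> j) *\<^sub>R s \<alpha>)"

definition M :: "nat \<Rightarrow> nat \<Rightarrow> 'r" where
  "M i j = X i * Y j - X j * Y i"

lemma S_sym: "i \<in> I \<Longrightarrow> j \<in> I \<Longrightarrow> S i j = S j i"
  unfolding S_def by (auto intro!: sum.cong simp: ab)

lemma YX_S: "i \<in> I \<Longrightarrow> j \<in> I \<Longrightarrow> Y i * X j = X j * Y i + S i j"
  unfolding S_def by (rule YX)

text \<open>Moving \<open>s \<alpha>\<close> to the right across \<open>Y m\<close> costs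
  \<open>a \<alpha> m\<close> times one vector \<open>V\<close>. In the cyclic sum each
  \<open>X k\<close> meets the product of the two other \<open>a\<close> coordinates twice, with
  opposite signs, so these corrections cancel.\<close>

lemma S_cyclic:
  assumes "i \<in> I" "j \<in> I" "k \<in> I" "l \<in> I"
  shows "X k * S j l * Y i - X i * S j l * Y k
       + (X i * S k l * Y j - X j * S k l * Y i)
       + (X j * S i l * Y k - X k * S i l * Y j)
       = M k i * S j l + M i j * S k l + M j k * S i l"
proof -
  \<comment> \<open>\<open>L\<close> and \<open>R\<close> are the reflection parts of the two sides.
    The Kronecker parts split off from them agree because \<open>e\<close> acts as a unit next to
    \<open>Y\<close>.\<close>
  define L where "L k i j = (\<Sum>\<alpha>\<in>P. (a \<alpha> j * b \<alpha> l) *\<^sub>R (X k * (s \<alpha> * Y i)))" for k i j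
  define R where "R k i j = (\<Sum>\<alpha>\<in>P. (a \<alpha> j * b \<alpha> l) *\<^sub>R (M k i * s \<alpha>))" for k i j
  have XSY: "X k * S j l * Y i = (if j = l then X k * Y i else 0) + L k i j"
    if "k \<in> I" "i \<in> I" for i j k
    using that by (simp add: S_def L_def distrib_left distrib_right sum_distrib_left sum_distrib_right
        mult.assoc X_e e_Y)
  have MS: "M k i * S j l = (if j = l then M k i else 0) + R k i j"
    if "k \<in> I" "i \<in> I" for i j k
    using that by (simp add: S_def M_def R_def algebra_simps sum_distrib_left sum_distrib_right Y_e
         sum_subtractf)
  have "(\<Sum>\<alpha>\<in>P. (a \<alpha> j * b \<alpha> l) *\<^sub>R (X k * (s \<alpha> * Y i)) - (a \<alpha> j * b \<alpha> l) *\<^sub>R (X i * (s \<alpha> * Y k))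
       + ((a \<alpha> k * b \<alpha> l) *\<^sub>R (X i * (s \<alpha> * Y j)) - (a \<alpha> k * b \<alpha> l) *\<^sub>R (X j * (s \<alpha> * Y i)))
       + ((a \<alpha> i * b \<alpha> l) *\<^sub>R (X j * (s \<alpha> * Y k)) - (a \<alpha> i * b \<alpha> l) *\<^sub>R (X k * (s \<alpha> * Y j))))
    = (\<Sum>\<alpha>\<in>P. (a \<alpha> j * b \<alpha> l) *\<^sub>R (M k i * s \<alpha>) + (a \<alpha> k * b \<alpha> l) *\<^sub>R (M i j * s \<alpha>)
       + (a \<alpha> i * b \<alpha> l) *\<^sub>R (M j k * s \<alpha>))" (is "sum ?L P = sum ?R P")
  proof (rule sum.cong[OF refl])
    fix \<alpha> assume \<alpha>: "\<alpha> \<in> P"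
    define V where "V = (\<Sum>m\<in>I. b \<alpha> m *\<^sub>R Y m)"
    have sY': "s \<alpha> * Y m = Y m * s \<alpha> - a \<alpha> m *\<^sub>R (V * s \<alpha>)" if "m \<in> I" for m
      using sY[OF \<alpha> that] by (simp add: V_def algebra_simps)
    show "?L \<alpha> = ?R \<alpha>"
      using assms by (simp add: sY' M_def algebra_simps)
  qed
  then have LR: "L k i j - L i k j + (L i j k - L j i k) + (L j k i - L k j i)
      = R k i j + R i j k + R j k i"
    by (simp add: L_def R_def sum.distrib sum_subtractf)
  have "X k * S j l * Y i - X i * S j l * Y k
       + (X i * S k l * Y j - X j * S k l * Y i)
       + (X j * S i l * Y k - X k * S i l * Y j)
      = (if j = l then M k i else 0) + (if k = l then M i j else 0) + (if i = l then M j k else 0)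
       + (L k i j - L i k j + (L i j k - L j i k) + (L j k i - L k j i))"
    using assms by (simp add: XSY M_def)
  then show ?thesis unfolding LR using assms by (simp add: MS)
qed

lemma M_mult_X:
  assumes "i \<in> I" "j \<in> I" "k \<in> I"
  shows "M i j * X k = X i * (X k * Y j) - X j * (X k * Y i) + X i * S j k - X j * S i k"
  using assms by (simp add: M_def algebra_simps YX_S)

text \<open>Expand the right factor of each product. The terms ending in \<open>Y l\<close> have the
  common left factor of \<open>c1\<close>, which vanishes since the \<open>X\<close> commute and
  \<open>S\<close> is symmetric. In the other terms the parts with two \<open>X\<close> and two
  \<open>Y\<close> cancel, and what survives is minus the sum evaluated by
  \<open>S_cyclic\<close>.\<close>

lemma M_crossing:
  assumes "i \<in> I" "j \<in> I" "k \<in> I" "l \<in> I"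
  shows "M i j * M k l + M j k * M i l + M k i * M j l = M i j * S k l + M j k * S i l + M k i * S j l"
proof -
  have X: "X u * (X v * z) = X v * (X u * z)" if "u \<in> I" "v \<in> I" for u v z
    using XX[OF that] by (metis mult.assoc)
  have Y: "Y u * Y v = Y v * Y u" if "u \<in> I" "v \<in> I" for u v
    using YY[OF that] .
  have MM: "M i j * M k l = M i j * X k * Y l - M i j * X l * Y k" for i j k
    by (simp add: M_def[of k l] right_diff_distrib mult.assoc)
  have c1: "M i j * X k + M j k * X i + M k i * X j = 0"
    using assms by (simp add: M_mult_X XX S_sym algebra_simps)
      (simp add: XX X S_sym)
  have c2: "M i j * X l * Y k + M j k * X l * Y i + M k i * X l * Y j
    = - (M k i * S j l + M i j * S k l + M j k * S i l)"
    unfolding S_cyclic[OF assms, symmetric]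
    using assms by (simp add: M_mult_X left_diff_distrib distrib_right mult.assoc)
      (simp add: Y X algebra_simps)
  have "M i j * M k l + M j k * M i l + M k i * M j l
      = (M i j * X k + M j k * X i + M k i * X j) * Y l
        - (M i j * X l * Y k + M j k * X l * Y i + M k i * X l * Y j)"
    unfolding MM by (simp add: algebra_simps)
  then show ?thesis unfolding c1 c2 by (simp add: algebra_simps)
qed

text \<open>A reflection changes both factors of \<open>M i j\<close>; the terms in which both are
  changed cancel by \<open>ab\<close>. The rest is regrouped into values of \<open>M\<close> alone,
  so that the relation still makes sense after \<open>X\<close> and \<open>Y\<close> have been
  eliminated.\<close>

lemma s_mult_M:
  assumes \<alpha>: "\<alpha> \<in> P" and ij: "i \<in> I" "j \<in> I"
  shows "s \<alpha> * M i j =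
    (M i j - (\<Sum>m\<in>I. (a \<alpha> m * b \<alpha> i) *\<^sub>R M m j) - (\<Sum>m\<in>I. (a \<alpha> j * b \<alpha> m) *\<^sub>R M i m)) * s \<alpha>"
proof -
  define U where "U = (\<Sum>m\<in>I. a \<alpha> m *\<^sub>R X m)"
  define V where "V = (\<Sum>m\<in>I. b \<alpha> m *\<^sub>R Y m)"
  have sX': "s \<alpha> * X m = (X m - b \<alpha> m *\<^sub>R U) * s \<alpha>" if "m \<in> I" for m
    using sX[OF \<alpha> that] by (simp add: U_def)
  have sY': "s \<alpha> * Y m = (Y m - a \<alpha> m *\<^sub>R V) * s \<alpha>" if "m \<in> I" for m
    using sY[OF \<alpha> that] by (simp add: V_def)
  have sXY: "s \<alpha> * (X k * Y l) = (X k - b \<alpha> k *\<^sub>R U) * (Y l - a \<alpha> l *\<^sub>R V) * s \<alpha>" if "k \<in> I" "l \<in> I" for k l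
    using that by (metis (no_types, lifting) sX' sY' mult.assoc)
  \<comment> \<open>By \<open>ab\<close> the free and the summed index may change places between
    \<open>a\<close> and \<open>b\<close>. This provides the second half of each \<open>M\<close> in
    the two sums below.\<close>
  have bU: "b \<alpha> k *\<^sub>R U = a \<alpha> k *\<^sub>R (\<Sum>m\<in>I. b \<alpha> m *\<^sub>R X m)" if "k \<in> I" for k
    unfolding U_def scaleR_sum_right using that ab[OF \<alpha>]
    by (intro sum.cong) (auto simp: mult.commute)
  have aV: "a \<alpha> k *\<^sub>R V = b \<alpha> k *\<^sub>R (\<Sum>m\<in>I. a \<alpha> m *\<^sub>R Y m)" if "k \<in> I" for k
    unfolding V_def scaleR_sum_right using that ab[OF \<alpha>]
    by (intro sum.cong) (auto simp: mult.commute)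
  have UY: "(\<Sum>m\<in>I. (a \<alpha> m * b \<alpha> i) *\<^sub>R M m j) = b \<alpha> i *\<^sub>R (U * Y j) - X j * (a \<alpha> i *\<^sub>R V)"
    unfolding aV[OF ij(1)] unfolding U_def M_def
    by (simp add: scaleR_sum_right sum_distrib_left sum_distrib_right algebra_simps sum_subtractf)
  have XV: "(\<Sum>m\<in>I. (a \<alpha> j * b \<alpha> m) *\<^sub>R M i m) = a \<alpha> j *\<^sub>R (X i * V) - b \<alpha> j *\<^sub>R U * Y i"
    unfolding bU[OF ij(2)] unfolding V_def M_def
    by (simp add: scaleR_sum_right sum_distrib_left sum_distrib_right algebra_simps sum_subtractf)
  have "a \<alpha> i * b \<alpha> j = a \<alpha> j * b \<alpha> i" by (rule ab[OF \<alpha> ij])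
  then show ?thesis
    unfolding UY XV M_def[of i j] right_diff_distrib sXY[OF ij] sXY[OF ij(2,1)]
    by (simp add: algebra_simps)
qed

end

section \<open>The square of the Dirac element from the crossing relation\<close>

lemma commute_mult:
  fixes u v w :: "'a::semigroup_mult"
  assumes "u * w = w * u" "v * w = w * v"
  shows "u * v * w = w * (u * v)"
  using assms by (metis mult.assoc)

text \<open>Small multiples become repeated sums, which leaves identities in an abelian group that
  cancellation settles.\<close>

lemma numeral_scaleR:
  "2 *\<^sub>R v = v + v" "3 *\<^sub>R v = v + v + v" "4 *\<^sub>R v = v + v + v + v"
  "6 *\<^sub>R v = v + v + v + v + v + v" for v :: "'v::real_vector"
  using scaleR_add_left[of 1 1 v] scaleR_add_left[of 2 1 v] scaleR_add_left[of 3 1 v]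
    scaleR_add_left[of 4 1 v] scaleR_add_left[of 5 1 v] by simp_all

text \<open>The relations left after eliminating \<open>X\<close> and \<open>Y\<close>, joined with
  Clifford generators \<open>\<gamma>\<close>. The unit laws are listed for each kind of generator
  because \<open>e\<close> is only an idempotent of the ambient algebra. \<open>S\<close> is a
  parameter, fixed by its values on \<open>I\<close>, so that it can be instantiated by images of
  elements of \<open>A\<close>.\<close>

locale ama_clifford_relations =
  fixes I :: "nat set" and P :: "'p set"
    and M :: "nat \<Rightarrow> nat \<Rightarrow> 'r::real_algebra" and s :: "'p \<Rightarrow> 'r" and e :: 'r
    and a b :: "'p \<Rightarrow> nat \<Rightarrow> real" and \<gamma> :: "nat \<Rightarrow> 'r" and S :: "nat \<Rightarrow> nat \<Rightarrow> 'r"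
  assumes finite_I: "finite I"
    and S_def: "\<And>i j. i \<in> I \<Longrightarrow> j \<in> I \<Longrightarrow>
      S i j = (if i = j then e else 0) + (\<Sum>\<alpha>\<in>P. (a \<alpha> i * b \<alpha> j) *\<^sub>R s \<alpha>)"
    and ab: "\<And>\<alpha> i j. \<alpha> \<in> P \<Longrightarrow> i \<in> I \<Longrightarrow> j \<in> I \<Longrightarrow> a \<alpha> i * b \<alpha> j = a \<alpha> j * b \<alpha> i"
    and ab_sum: "\<And>\<alpha>. \<alpha> \<in> P \<Longrightarrow> (\<Sum>m\<in>I. a \<alpha> m * b \<alpha> m) = 2"
    and M_antisym: "\<And>i j. i \<in> I \<Longrightarrow> j \<in> I \<Longrightarrow> M i j = - M j i"
    and crossing: "\<And>i j k l. i \<in> I \<Longrightarrow> j \<in> I \<Longrightarrow> k \<in> I \<Longrightarrow> l \<in> I \<Longrightarrow>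
      M i j * M k l + M j k * M i l + M k i * M j l = M i j * S k l + M j k * S i l + M k i * S j l"
    and sM: "\<And>\<alpha> i j. \<alpha> \<in> P \<Longrightarrow> i \<in> I \<Longrightarrow> j \<in> I \<Longrightarrow> s \<alpha> * M i j =
      (M i j - (\<Sum>m\<in>I. (a \<alpha> m * b \<alpha> i) *\<^sub>R M m j) - (\<Sum>m\<in>I. (a \<alpha> j * b \<alpha> m) *\<^sub>R M i m)) * s \<alpha>"
    and \<gamma>\<gamma>: "\<And>i j. i \<in> I \<Longrightarrow> j \<in> I \<Longrightarrow> \<gamma> i * \<gamma> j + \<gamma> j * \<gamma> i = (if i = j then 2 *\<^sub>R e else 0)"
    and \<gamma>M: "\<And>i j k. i \<in> I \<Longrightarrow> j \<in> I \<Longrightarrow> k \<in> I \<Longrightarrow> \<gamma> k * M i j = M i j * \<gamma> k"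
    and \<gamma>s: "\<And>\<alpha> k. \<alpha> \<in> P \<Longrightarrow> k \<in> I \<Longrightarrow> \<gamma> k * s \<alpha> = s \<alpha> * \<gamma> k"
    and M_e: "\<And>i j. i \<in> I \<Longrightarrow> j \<in> I \<Longrightarrow> M i j * e = M i j"
    and s_e: "\<And>\<alpha>. \<alpha> \<in> P \<Longrightarrow> s \<alpha> * e = s \<alpha>"
    and e_e: "e * e = e"
    and \<gamma>_e: "\<And>k. k \<in> I \<Longrightarrow> \<gamma> k * e = \<gamma> k" and e_\<gamma>: "\<And>k. k \<in> I \<Longrightarrow> e * \<gamma> k = \<gamma> k"
begin

lemma S_sym: "i \<in> I \<Longrightarrow> j \<in> I \<Longrightarrow> S i j = S j i"
  by (auto intro!: sum.cong simp: ab S_def)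

lemma M_refl: "i \<in> I \<Longrightarrow> M i i = 0"
  using M_antisym[of i i] by (metis add_eq_0_iff scaleR_half_double scaleR_zero_right)

lemma S_e: "i \<in> I \<Longrightarrow> j \<in> I \<Longrightarrow> S i j * e = S i j"
  by (simp add: S_def distrib_right e_e sum_distrib_right s_e)

lemma \<gamma>_swap:
  "i \<in> I \<Longrightarrow> j \<in> I \<Longrightarrow> \<gamma> i * \<gamma> j = (if i = j then 2 *\<^sub>R e else 0) - \<gamma> j * \<gamma> i"
  using \<gamma>\<gamma>[of i j] by (simp add: algebra_simps)

lemma sum_rotate: "(\<Sum>i\<in>I. \<Sum>j\<in>I. \<Sum>k\<in>I. f j k i) = (\<Sum>i\<in>I. \<Sum>j\<in>I. \<Sum>k\<in>I. f i j k)"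
  for f :: "nat \<Rightarrow> nat \<Rightarrow> nat \<Rightarrow> 'r"
  by (rule trans[OF sum.swap]) (intro sum.cong refl sum.swap)

text \<open>\<open>\<gamma> i\<close> passes two generators: the two signs cancel, and each passage
  leaves one contraction.\<close>

lemma \<gamma>_rotate:
  assumes "i \<in> I" "j \<in> I" "k \<in> I"
  shows "\<gamma> i * \<gamma> j * \<gamma> k = \<gamma> j * \<gamma> k * \<gamma> i
    - (if k = i then 2 *\<^sub>R \<gamma> j else 0) + (if i = j then 2 *\<^sub>R \<gamma> k else 0)"
proof -
  have "\<gamma> i * \<gamma> j * \<gamma> k = (if i = j then 2 *\<^sub>R \<gamma> k else 0) - \<gamma> j * (\<gamma> i * \<gamma> k)"
    using assms by (simp add: \<gamma>_swap[of i j] left_diff_distrib e_\<gamma> mult.assoc)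
  also have "\<gamma> j * (\<gamma> i * \<gamma> k) = (if k = i then 2 *\<^sub>R \<gamma> j else 0) - \<gamma> j * \<gamma> k * \<gamma> i"
    using assms by (simp add: \<gamma>_swap[of i k] right_diff_distrib \<gamma>_e mult.assoc)
  finally show ?thesis by simp
qed

section \<open>Sums against products of four and of two Clifford generators\<close>

definition quad :: "(nat \<Rightarrow> nat \<Rightarrow> nat \<Rightarrow> nat \<Rightarrow> 'r) \<Rightarrow> 'r" where
  "quad G = (\<Sum>i\<in>I. \<Sum>j\<in>I. \<Sum>k\<in>I. \<Sum>l\<in>I. G i j k l * (\<gamma> i * \<gamma> j * \<gamma> k * \<gamma> l))"

definition bil :: "(nat \<Rightarrow> nat \<Rightarrow> 'r) \<Rightarrow> 'r" where
  "bil F = (\<Sum>i\<in>I. \<Sum>l\<in>I. F i l * (\<gamma> i * \<gamma> l))"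

text \<open>After \<open>\<gamma>_rotate\<close> the leading term is \<open>quad G\<close> with its
  summation indices renamed. Each contraction identifies two of the four indices and leaves two
  generators.\<close>

lemma quad_rotate:
  "quad (\<lambda>i j k l. G j k i l) = quad G
     - 2 *\<^sub>R bil (\<lambda>i l. \<Sum>m\<in>I. G i m m l) + 2 *\<^sub>R bil (\<lambda>i l. \<Sum>m\<in>I. G m i m l)"
proof -
  have "quad (\<lambda>i j k l. G j k i l) = (\<Sum>i\<in>I. \<Sum>j\<in>I. \<Sum>k\<in>I. \<Sum>l\<in>I.
      G j k i l * (\<gamma> j * \<gamma> k * \<gamma> i * \<gamma> l)
      - (if k = i then 2 *\<^sub>R (G j k i l * (\<gamma> j * \<gamma> l)) else 0)
      + (if j = i then 2 *\<^sub>R (G j k i l * (\<gamma> k * \<gamma> l)) else 0))"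
    unfolding quad_def
  proof (intro sum.cong refl)
    fix i j k l assume "i \<in> I" "j \<in> I" "k \<in> I" "l \<in> I"
    then show "G j k i l * (\<gamma> i * \<gamma> j * \<gamma> k * \<gamma> l) = G j k i l * (\<gamma> j * \<gamma> k * \<gamma> i * \<gamma> l)
      - (if k = i then 2 *\<^sub>R (G j k i l * (\<gamma> j * \<gamma> l)) else 0)
      + (if j = i then 2 *\<^sub>R (G j k i l * (\<gamma> k * \<gamma> l)) else 0)"
      by (subst \<gamma>_rotate) (simp_all only: left_diff_distrib right_diff_distrib distrib_left distrib_right,
        auto)
  qed
  also have "\<dots> = (\<Sum>i\<in>I. \<Sum>j\<in>I. \<Sum>k\<in>I. \<Sum>l\<in>I. G j k i l * (\<gamma> j * \<gamma> k * \<gamma> i * \<gamma> l))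
    - (\<Sum>i\<in>I. \<Sum>j\<in>I. \<Sum>k\<in>I. if k = i then \<Sum>l\<in>I. 2 *\<^sub>R (G j k i l * (\<gamma> j * \<gamma> l)) else 0)
    + (\<Sum>i\<in>I. \<Sum>j\<in>I. if j = i then \<Sum>k\<in>I. \<Sum>l\<in>I. 2 *\<^sub>R (G j k i l * (\<gamma> k * \<gamma> l)) else 0)"
    unfolding sum.distrib sum_subtractf
    by (intro arg_cong2[of _ _ _ _ "(+)"] arg_cong2[of _ _ _ _ "(-)"] sum.cong refl) simp_all
  also have "(\<Sum>i\<in>I. \<Sum>j\<in>I. \<Sum>k\<in>I. \<Sum>l\<in>I. G j k i l * (\<gamma> j * \<gamma> k * \<gamma> i * \<gamma> l)) = quad G"
    unfolding quad_def by (rule sum_rotate)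
  also have "(\<Sum>i\<in>I. \<Sum>j\<in>I. \<Sum>k\<in>I. if k = i then \<Sum>l\<in>I. 2 *\<^sub>R (G j k i l * (\<gamma> j * \<gamma> l)) else 0)
    = 2 *\<^sub>R bil (\<lambda>i l. \<Sum>m\<in>I. G i m m l)"
    unfolding bil_def sum_distrib_right scaleR_sum_right
    using finite_I by simp (rule trans[OF sum.swap], intro sum.cong refl sum.swap)
  also have "(\<Sum>i\<in>I. \<Sum>j\<in>I. if j = i then \<Sum>k\<in>I. \<Sum>l\<in>I. 2 *\<^sub>R (G j k i l * (\<gamma> k * \<gamma> l)) else 0)
    = 2 *\<^sub>R bil (\<lambda>i l. \<Sum>m\<in>I. G m i m l)"
    unfolding bil_def sum_distrib_right scaleR_sum_right
    using finite_I by simp (rule trans[OF sum.swap], intro sum.cong refl sum.swap)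
  finally show ?thesis .
qed

lemma quad_add: "quad (\<lambda>i j k l. F i j k l + G i j k l) = quad F + quad G"
  by (simp add: quad_def distrib_right sum.distrib)

lemma quad_cong:
  "(\<And>i j k l. i \<in> I \<Longrightarrow> j \<in> I \<Longrightarrow> k \<in> I \<Longrightarrow> l \<in> I \<Longrightarrow> F i j k l = G i j k l) \<Longrightarrow> quad F = quad G"
  unfolding quad_def by (intro sum.cong refl) simp

lemma bil_cong:
  "(\<And>i l. i \<in> I \<Longrightarrow> l \<in> I \<Longrightarrow> F i l = G i l) \<Longrightarrow> bil F = bil G"
  unfolding bil_def by (intro sum.cong refl) simp

lemma bil_add: "bil (\<lambda>i l. F i l + G i l) = bil F + bil G"
  by (simp add: bil_def distrib_right sum.distrib)

lemma bil_diff: "bil (\<lambda>i l. F i l - G i l) = bil F - bil G"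
  by (simp add: bil_def left_diff_distrib sum_subtractf)

lemma bil_minus: "bil (\<lambda>i l. - F i l) = - bil F"
  by (simp add: bil_def sum_negf)

text \<open>Exchanging the two generators changes the sign, except that equal indices contribute a
  contraction and thereby the trace. The hypothesis absorbs the unit \<open>e\<close> of that
  contraction.\<close>

lemma bil_swap:
  assumes "\<And>i l. i \<in> I \<Longrightarrow> l \<in> I \<Longrightarrow> F i l * e = F i l"
  shows "bil (\<lambda>i l. F l i) = 2 *\<^sub>R (\<Sum>i\<in>I. F i i) - bil F"
proof -
  have "bil (\<lambda>i l. F l i) = (\<Sum>i\<in>I. \<Sum>l\<in>I. (if i = l then 2 *\<^sub>R F i l else 0) - F l i * (\<gamma> l * \<gamma> i))"
    unfolding bil_def
    by (intro sum.cong refl, subst \<gamma>_swap) (simp_all add: assms right_diff_distrib)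
  also have "\<dots> = 2 *\<^sub>R (\<Sum>i\<in>I. F i i) - (\<Sum>i\<in>I. \<Sum>l\<in>I. F l i * (\<gamma> l * \<gamma> i))"
    using finite_I by (simp add: sum_subtractf scaleR_sum_right)
  also have "(\<Sum>i\<in>I. \<Sum>l\<in>I. F l i * (\<gamma> l * \<gamma> i)) = bil F"
    unfolding bil_def by (rule sum.swap)
  finally show ?thesis .
qed

text \<open>Count the contractions. The first rotation produces \<open>M i m * B m l\<close> and
  \<open>M m i * B m l\<close> with opposite signs, which antisymmetry merges into four copies. The
  second rotation starts from those four; it loses one contraction to \<open>M m m = 0\<close> and
  gives two copies back. Hence 4 + (4 - 2) = 6. \<open>B\<close> stays general so that both sides of
  the crossing relation, with \<open>M\<close> and with \<open>S\<close>, are covered.\<close>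

lemma quad_cyclic:
  "quad (\<lambda>i j k l. M i j * B k l + M j k * B i l + M k i * B j l)
    = 3 *\<^sub>R quad (\<lambda>i j k l. M i j * B k l) - 6 *\<^sub>R bil (\<lambda>i l. \<Sum>m\<in>I. M i m * B m l)"
proof -
  let ?G = "\<lambda>i j k l. M i j * B k l"
  define N where "N = bil (\<lambda>i l. \<Sum>m\<in>I. M i m * B m l)"
  have N': "bil (\<lambda>i l. \<Sum>m\<in>I. M m i * B m l) = - N"
    unfolding N_def bil_minus[symmetric]
    by (rule bil_cong, unfold sum_negf[symmetric], rule sum.cong[OF refl])
      (metis M_antisym mult_minus_left)
  have 1: "quad (\<lambda>i j k l. M j k * B i l) = quad ?G - 4 *\<^sub>R N"
    using quad_rotate[of ?G]
    by (simp add: N_def[symmetric] N' numeral_scaleR)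
  have 2: "quad (\<lambda>i j k l. M k i * B j l) = quad (\<lambda>i j k l. M j k * B i l)
      - 2 *\<^sub>R bil (\<lambda>i l. \<Sum>m\<in>I. M m m * B i l) + 2 *\<^sub>R N"
    using quad_rotate[of "\<lambda>i j k l. M j k * B i l"] by (simp add: N_def)
  have 3: "bil (\<lambda>i l. \<Sum>m\<in>I. M m m * B i l) = 0"
    unfolding bil_def by (simp add: M_refl)
  show ?thesis
    unfolding quad_add 2 3 1 N_def[symmetric]
    by (simp add: numeral_scaleR)
qed

lemma bil_mult:
  assumes "\<And>i j k. i \<in> I \<Longrightarrow> j \<in> I \<Longrightarrow> k \<in> I \<Longrightarrow> \<gamma> k * B i j = B i j * \<gamma> k"
  shows "bil F * bil B = quad (\<lambda>i j k l. F i j * B k l)"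
proof -
  have "\<gamma> i * \<gamma> j * B k l = B k l * (\<gamma> i * \<gamma> j)" if "i \<in> I" "j \<in> I" "k \<in> I" "l \<in> I" for i j k l
    using that by (intro commute_mult assms)
  then have "F i j * (\<gamma> i * \<gamma> j) * (B k l * (\<gamma> k * \<gamma> l)) = F i j * B k l * (\<gamma> i * \<gamma> j * \<gamma> k * \<gamma> l)"
    if "i \<in> I" "j \<in> I" "k \<in> I" "l \<in> I" for i j k l
    using that by (metis (no_types) mult.assoc[of "F i j"] mult.assoc[of "B k l"]
      mult.assoc[of "\<gamma> i * \<gamma> j"])
  then show ?thesis
    unfolding bil_def[of F] quad_def sum_distrib_right
    unfolding bil_def sum_distrib_left by (intro sum.cong refl) simp
qed

lemma sum_antisym:
  assumes "\<And>i j. i \<in> I \<Longrightarrow> j \<in> I \<Longrightarrow> F j i = - F i j"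
  shows "(\<Sum>i\<in>I. \<Sum>j\<in>I. F i j) = (0 :: 'r)"
proof -
  have "(\<Sum>i\<in>I. \<Sum>j\<in>I. F i j) = (\<Sum>j\<in>I. \<Sum>i\<in>I. F i j)" by (rule sum.swap)
  also have "\<dots> = - (\<Sum>i\<in>I. \<Sum>j\<in>I. F i j)"
    unfolding sum_negf[symmetric] by (intro sum.cong refl assms)
  finally show ?thesis
    by (metis add_eq_0_iff scaleR_half_double scaleR_zero_right)
qed

section \<open>The Dirac element and its relation to S and Z\<close>

definition D :: 'r where "D = (1/2) *\<^sub>R bil M"

definition Z :: 'r where "Z = (\<Sum>\<alpha>\<in>P. s \<alpha>)"

definition K :: 'r where "K = bil (\<lambda>i l. \<Sum>m\<in>I. M i m * S m l)"

lemma \<gamma>S: "i \<in> I \<Longrightarrow> j \<in> I \<Longrightarrow> k \<in> I \<Longrightarrow> \<gamma> k * S i j = S i j * \<gamma> k"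
  by (simp add: S_def distrib_left distrib_right e_\<gamma> \<gamma>_e sum_distrib_left sum_distrib_right \<gamma>s)

text \<open>Symmetric coefficients see only the anticommutators of the generators, hence only the
  diagonal.\<close>

lemma bil_S: "bil S = (\<Sum>k\<in>I. S k k)"
proof -
  have "bil S = bil (\<lambda>i l. S l i)" by (rule bil_cong) (rule S_sym)
  also have "\<dots> = 2 *\<^sub>R (\<Sum>k\<in>I. S k k) - bil S" by (rule bil_swap) (rule S_e)
  finally have "2 *\<^sub>R bil S = 2 *\<^sub>R (\<Sum>k\<in>I. S k k)" by (simp add: scaleR_2 algebra_simps)
  then show ?thesis by simp
qed

lemma sum_S: "(\<Sum>k\<in>I. S k k) = real (card I) *\<^sub>R e + 2 *\<^sub>R Z"
proof -
  have "(\<Sum>k\<in>I. S k k) = real (card I) *\<^sub>R e + (\<Sum>k\<in>I. \<Sum>\<alpha>\<in>P. (a \<alpha> k * b \<alpha> k) *\<^sub>R s \<alpha>)"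
    by (simp add: S_def sum.distrib sum_constant_scaleR)
  also have "(\<Sum>k\<in>I. \<Sum>\<alpha>\<in>P. (a \<alpha> k * b \<alpha> k) *\<^sub>R s \<alpha>) = (\<Sum>\<alpha>\<in>P. (\<Sum>k\<in>I. a \<alpha> k * b \<alpha> k) *\<^sub>R s \<alpha>)"
    unfolding scaleR_sum_left by (rule sum.swap)
  also have "\<dots> = 2 *\<^sub>R Z" by (simp add: ab_sum Z_def scaleR_sum_right)
  finally show ?thesis .
qed

lemma bil_M_e: "bil M * e = bil M"
  unfolding bil_def sum_distrib_right by (intro sum.cong refl) (simp add: mult.assoc \<gamma>_e)

text \<open>The quartic sum factors as \<open>bil M * bil S\<close>, and the second factor is the
  trace of \<open>S\<close>.\<close>

lemma quad_MS: "quad (\<lambda>i j k l. M i j * S k l) = 2 *\<^sub>R (real (card I) *\<^sub>R D + 2 *\<^sub>R (D * Z))"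
proof -
  have "quad (\<lambda>i j k l. M i j * S k l) = bil M * (real (card I) *\<^sub>R e + 2 *\<^sub>R Z)"
    using bil_mult[of S M, OF \<gamma>S] by (simp add: bil_S sum_S)
  then show ?thesis
    by (simp add: D_def distrib_left bil_M_e scaleR_add_right)
qed

text \<open>The Kronecker part of \<open>S\<close> contributes \<open>bil M\<close>, which is twice
  \<open>D\<close>. The part belonging to \<open>\<alpha>\<close> contributes
  \<open>bil (A \<alpha>)\<close>, and \<open>A \<alpha>\<close> is also the correction term in
  \<open>sM\<close>: it appears there with its transpose and the opposite sign. Under
  \<open>bil\<close> the two add up, so commuting \<open>s \<alpha>\<close> with
  \<open>bil M\<close> costs twice \<open>bil (A \<alpha>)\<close>, and the factor 1/2 in
  \<open>D\<close> removes the 2.\<close>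

lemma K_commutator: "K = 2 *\<^sub>R D + (D * Z - Z * D)"
proof -
  define A where "A \<alpha> i l = (\<Sum>m\<in>I. (a \<alpha> m * b \<alpha> l) *\<^sub>R (M i m * s \<alpha>))" for \<alpha> i l
  have A: "bil (A \<alpha>) = D * s \<alpha> - s \<alpha> * D" if \<alpha>: "\<alpha> \<in> P" for \<alpha>
  proof -
    have \<gamma>\<gamma>s: "\<gamma> i * \<gamma> j * s \<alpha> = s \<alpha> * (\<gamma> i * \<gamma> j)" if "i \<in> I" "j \<in> I" for i j
      using that \<alpha> by (intro commute_mult \<gamma>s)
    \<comment> \<open>Symmetric coefficients meet the antisymmetric \<open>M\<close>. With zero
      trace, \<open>bil_swap\<close> makes transposition of \<open>A \<alpha>\<close> a change of
      sign.\<close>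
    have A0: "(\<Sum>i\<in>I. A \<alpha> i i) = 0"
      unfolding A_def
    proof (rule sum_antisym)
      fix i j assume "i \<in> I" "j \<in> I"
      then show "(a \<alpha> i * b \<alpha> j) *\<^sub>R (M j i * s \<alpha>) = - ((a \<alpha> j * b \<alpha> i) *\<^sub>R (M i j * s \<alpha>))"
        using ab[OF \<alpha>, of i j] M_antisym[of j i] by simp
    qed
    have "bil (\<lambda>i l. A \<alpha> l i) = 2 *\<^sub>R (\<Sum>i\<in>I. A \<alpha> i i) - bil (A \<alpha>)"
      by (rule bil_swap) (simp add: A_def sum_distrib_right mult.assoc s_e \<alpha>)
    then have A_swap: "bil (\<lambda>i l. A \<alpha> l i) = - bil (A \<alpha>)" by (simp add: A0)
    have "s \<alpha> * bil M = bil (\<lambda>i l. s \<alpha> * M i l)"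
      by (simp add: bil_def sum_distrib_left mult.assoc)
    also have "\<dots> = bil (\<lambda>i l. M i l * s \<alpha> + A \<alpha> l i - A \<alpha> i l)"
    proof (rule bil_cong)
      fix i l assume il: "i \<in> I" "l \<in> I"
      have "- (\<Sum>m\<in>I. (a \<alpha> m * b \<alpha> i) *\<^sub>R M m l) * s \<alpha> = A \<alpha> l i"
        unfolding A_def sum_distrib_right sum_negf[symmetric]
        by (intro sum.cong refl, subst M_antisym) (auto simp: il)
      moreover have "(\<Sum>m\<in>I. (a \<alpha> l * b \<alpha> m) *\<^sub>R M i m) * s \<alpha> = A \<alpha> i l"
        unfolding A_def sum_distrib_right
        by (intro sum.cong refl, subst ab) (auto simp: il \<alpha>)
      ultimately show "s \<alpha> * M i l = M i l * s \<alpha> + A \<alpha> l i - A \<alpha> i l"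
        by (simp add: sM \<alpha> il left_diff_distrib)
    qed
    also have "\<dots> = bil M * s \<alpha> - 2 *\<^sub>R bil (A \<alpha>)"
      unfolding bil_diff bil_add A_swap
      by (simp add: bil_def sum_distrib_right mult.assoc \<gamma>\<gamma>s[unfolded mult.assoc] scaleR_2)
    finally show ?thesis by (simp add: D_def scaleR_diff_right[symmetric])
  qed
  have "K = bil (\<lambda>i l. M i l + (\<Sum>\<alpha>\<in>P. A \<alpha> i l))"
    unfolding K_def
  proof (rule bil_cong)
    fix i l assume il: "i \<in> I" "l \<in> I"
    have "(\<Sum>m\<in>I. M i m * S m l)
      = (\<Sum>m\<in>I. (if m = l then M i m else 0) + (\<Sum>\<alpha>\<in>P. (a \<alpha> m * b \<alpha> l) *\<^sub>R (M i m * s \<alpha>)))"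
      by (intro sum.cong refl) (auto simp: S_def il distrib_left M_e sum_distrib_left)
    also have "\<dots> = M i l + (\<Sum>m\<in>I. \<Sum>\<alpha>\<in>P. (a \<alpha> m * b \<alpha> l) *\<^sub>R (M i m * s \<alpha>))"
      using finite_I il by (simp add: sum.distrib)
    also have "\<dots> = M i l + (\<Sum>\<alpha>\<in>P. A \<alpha> i l)"
      unfolding A_def by (subst sum.swap) (rule refl)
    finally show "(\<Sum>m\<in>I. M i m * S m l) = M i l + (\<Sum>\<alpha>\<in>P. A \<alpha> i l)" .
  qed
  also have "\<dots> = 2 *\<^sub>R D + bil (\<lambda>i l. \<Sum>\<alpha>\<in>P. A \<alpha> i l)"
    by (simp add: bil_add D_def)
  also have "bil (\<lambda>i l. \<Sum>\<alpha>\<in>P. A \<alpha> i l) = (\<Sum>\<alpha>\<in>P. bil (A \<alpha>))"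
    unfolding bil_def sum_distrib_right
    by (rule trans[OF sum.cong[OF refl sum.swap] sum.swap])
  also have "\<dots> = D * Z - Z * D"
    by (simp add: A Z_def sum_subtractf sum_distrib_left sum_distrib_right)
  finally show ?thesis .
qed

text \<open>Compare \<open>F\<close> with its transpose. Their difference consists of commutators of
  the \<open>M\<close>, which the crossing relation with a repeated index evaluates; by
  \<open>bil_swap\<close> the same difference is twice \<open>bil F\<close> minus twice the trace of
  \<open>F\<close>. That trace is minus the sum of all squares, which is where the Casimir-like term
  of the theorem originates.\<close>

lemma commutator_sum:
  "2 *\<^sub>R bil (\<lambda>i l. \<Sum>m\<in>I. M i m * M m l)
    = quad (\<lambda>i j k l. M i j * S k l) - 2 *\<^sub>R K - 2 *\<^sub>R (\<Sum>i\<in>I. \<Sum>j\<in>I. M i j * M i j)"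
proof -
  define F where "F i l = (\<Sum>m\<in>I. M i m * M m l)" for i l
  define H where "H i l = (\<Sum>m\<in>I. M i m * S m l)" for i l
  have H0: "(\<Sum>i\<in>I. H i i) = 0"
    unfolding H_def
  proof (rule sum_antisym)
    fix i j assume "i \<in> I" "j \<in> I"
    then show "M j i * S i j = - (M i j * S j i)"
      using M_antisym[of j i] S_sym[of i j] by simp
  qed
  have K: "K = bil H" by (simp add: K_def H_def[abs_def])
  have "bil (\<lambda>i l. H l i) = 2 *\<^sub>R (\<Sum>i\<in>I. H i i) - bil H"
    by (rule bil_swap) (simp add: H_def sum_distrib_right mult.assoc S_e)
  then have H_swap: "bil (\<lambda>i l. H l i) = - K" by (simp add: H0 K)
  have F_diag: "(\<Sum>i\<in>I. F i i) = - (\<Sum>i\<in>I. \<Sum>j\<in>I. M i j * M i j)"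
    unfolding F_def sum_negf[symmetric]
    by (intro sum.cong refl) (metis M_antisym mult_minus_right)
  have F_swap: "bil (\<lambda>i l. F l i) = 2 *\<^sub>R (\<Sum>i\<in>I. F i i) - bil F"
    by (rule bil_swap) (simp add: F_def sum_distrib_right mult.assoc M_e)
  have "bil F - bil (\<lambda>i l. F l i) = bil (\<lambda>i l. F i l - F l i)"
    by (simp add: bil_diff)
  also have "\<dots> = bil (\<lambda>i l. M i l * (\<Sum>m\<in>I. S m m) - H i l + H l i)"
  proof (rule bil_cong)
    fix i l assume il: "i \<in> I" "l \<in> I"
    have "M i m * M m l - M l m * M m i = M i l * S m m - M i m * S m l + M l m * S m i" if m: "m \<in> I" for m
    proof -
      have *: "M l m = - M m l" "M m i = - M i m" "M l i = - M i l" "M m m = 0"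
        by (rule M_antisym M_refl il m)+
      show ?thesis
        using crossing[OF il(1) m il(2) m] S_sym[OF m il(1)] S_sym[OF m il(2)]
        unfolding * by (simp add: algebra_simps)
    qed
    then have "F i l - F l i = (\<Sum>m\<in>I. M i l * S m m - M i m * S m l + M l m * S m i)"
      unfolding F_def sum_subtractf[symmetric] by (rule sum.cong[OF refl])
    then show "F i l - F l i = M i l * (\<Sum>m\<in>I. S m m) - H i l + H l i"
      by (simp add: H_def sum_subtractf sum.distrib sum_distrib_left)
  qed
  also have "\<dots> = bil (\<lambda>i l. M i l * bil S) - 2 *\<^sub>R K"
    unfolding bil_add bil_diff H_swap by (simp add: K bil_S scaleR_2)
  also have "bil (\<lambda>i l. M i l * bil S) = bil M * bil S"
  proof -
    have "\<gamma> k * bil S = bil S * \<gamma> k" if "k \<in> I" for k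
      using that by (simp add: bil_S sum_distrib_left sum_distrib_right \<gamma>S)
    then have "bil S * (\<gamma> i * \<gamma> j) = \<gamma> i * \<gamma> j * bil S" if "i \<in> I" "j \<in> I" for i j
      using that by (intro commute_mult[symmetric])
    then show ?thesis
      unfolding bil_def[of M] bil_def[of "\<lambda>i l. M i l * bil S"] sum_distrib_right
      by (intro sum.cong refl) (simp add: mult.assoc)
  qed
  also have "bil M * bil S = quad (\<lambda>i j k l. M i j * S k l)"
    by (rule bil_mult) (rule \<gamma>S)
  finally show ?thesis
    unfolding F_swap F_diag by (simp add: F_def[abs_def] scaleR_2 algebra_simps)
qed

text \<open>The crossing relation yields \<open>Q = T - 2 K + 2 N\<close> after division by 3, and
  inserting \<open>N\<close> gives \<open>4 D D = 2 T - 4 K - 2 W\<close>. Now T/2 contains 2 D Z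
  and K contains D Z - Z D; their difference is the anticommutator.\<close>

theorem D_square:
  "D * D = - ((1/2) *\<^sub>R (\<Sum>i\<in>I. \<Sum>j\<in>I. M i j * M i j)) + (real (card I) - 2) *\<^sub>R D + (D * Z + Z * D)"
proof -
  define Q where "Q = quad (\<lambda>i j k l. M i j * M k l)"
  define T where "T = quad (\<lambda>i j k l. M i j * S k l)"
  define N where "N = bil (\<lambda>i l. \<Sum>m\<in>I. M i m * M m l)"
  define W where "W = (\<Sum>i\<in>I. \<Sum>j\<in>I. M i j * M i j)"
  have "3 *\<^sub>R Q - 6 *\<^sub>R N = 3 *\<^sub>R T - 6 *\<^sub>R K"
    using quad_cyclic[of M] quad_cyclic[of S] quad_cong[OF crossing]
    by (simp add: Q_def T_def N_def K_def)
  then have "3 *\<^sub>R Q = 3 *\<^sub>R (T - 2 *\<^sub>R K + 2 *\<^sub>R N)"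
    by (simp add: algebra_simps)
  then have Q: "Q = T - 2 *\<^sub>R K + 2 *\<^sub>R N" by (metis scaleR_cancel_left zero_neq_numeral)
  have N: "2 *\<^sub>R N = T - 2 *\<^sub>R K - 2 *\<^sub>R W"
    unfolding N_def T_def W_def by (rule commutator_sum)
  have "D * D = (1/4) *\<^sub>R Q"
    using bil_mult[of M M, OF \<gamma>M] by (simp add: D_def Q_def)
  also have "\<dots> = (1/2) *\<^sub>R T - K - (1/2) *\<^sub>R W"
    unfolding Q N by (simp add: algebra_simps scaleR_left.add[symmetric] flip: scaleR_add_left)
  also have "(1/2) *\<^sub>R T = real (card I) *\<^sub>R D + 2 *\<^sub>R (D * Z)"
    unfolding T_def quad_MS by simp
  finally show ?thesis
    unfolding K_commutator W_def by (simp add: algebra_simps scaleR_2)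
qed

end

section \<open>Complex algebras\<close>

locale complex_algebra = ring A for A :: "(complex, 'a) module" (structure) +
  assumes smult_closed [simp, intro]: "a \<in> carrier A \<Longrightarrow> z \<odot> a \<in> carrier A"
    and smult_add_right: "a \<in> carrier A \<Longrightarrow> b \<in> carrier A \<Longrightarrow> z \<odot> (a \<oplus> b) = z \<odot> a \<oplus> z \<odot> b"
    and smult_add_left: "a \<in> carrier A \<Longrightarrow> (z + w) \<odot> a = z \<odot> a \<oplus> w \<odot> a"
    and smult_smult: "a \<in> carrier A \<Longrightarrow> z \<odot> (w \<odot> a) = (z * w) \<odot> a"
    and smult_one: "a \<in> carrier A \<Longrightarrow> 1 \<odot> a = a"
    and mult_smult_left: "a \<in> carrier A \<Longrightarrow> b \<in> carrier A \<Longrightarrow> (z \<odot> a) \<otimes> b = z \<odot> (a \<otimes> b)"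
    and mult_smult_right: "a \<in> carrier A \<Longrightarrow> b \<in> carrier A \<Longrightarrow> a \<otimes> (z \<odot> b) = z \<odot> (a \<otimes> b)"
begin

lemma smult_minus_one: "a \<in> carrier A \<Longrightarrow> (-1) \<odot> a = \<ominus> a"
proof -
  assume a: "a \<in> carrier A"
  have 0: "0 \<odot> a \<oplus> 0 \<odot> a = 0 \<odot> a"
    using smult_add_left[OF a, of 0 0] by simp
  then have "0 \<odot> a = \<zero>"
    using a by (metis add.r_cancel_one' smult_closed)
  moreover have "(-1) \<odot> a \<oplus> a = 0 \<odot> a"
    using smult_add_left[OF a, of "-1" 1] a by (simp add: smult_one)
  ultimately show ?thesis
    using a by (metis minus_equality smult_closed)
qed

lemma minus_eq_smult: "a \<in> carrier A \<Longrightarrow> b \<in> carrier A \<Longrightarrow> a \<ominus> b = a \<oplus> (-1) \<odot> b"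
  by (simp add: smult_minus_one a_minus_def)

end

text \<open>Linearity is asked over the reals because the target class is
  \<open>real_algebra\<close>; the complex parameters are carried inside \<open>gs\<close> later on.
  There is no condition on the unit, since the maps in question send it to an idempotent.\<close>

locale algebra_map = complex_algebra A for A :: "(complex, 'a) module" (structure) +
  fixes f :: "'a \<Rightarrow> 'r::real_algebra"
  assumes map_add: "a \<in> carrier A \<Longrightarrow> b \<in> carrier A \<Longrightarrow> f (a \<oplus> b) = f a + f b"
    and map_mult: "a \<in> carrier A \<Longrightarrow> b \<in> carrier A \<Longrightarrow> f (a \<otimes> b) = f a * f b"
    and map_smult: "a \<in> carrier A \<Longrightarrow> f (complex_of_real r \<odot> a) = r *\<^sub>R f a"
begin

lemma map_zero: "f \<zero> = 0"
  using map_add[of \<zero> \<zero>] by simp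

lemma map_neg: "a \<in> carrier A \<Longrightarrow> f (\<ominus> a) = - f a"
  using map_smult[of a "-1"] by (simp add: smult_minus_one)

lemma map_diff: "a \<in> carrier A \<Longrightarrow> b \<in> carrier A \<Longrightarrow> f (a \<ominus> b) = f a - f b"
  by (simp add: a_minus_def map_add map_neg)

lemma map_finsum: "F \<in> S \<rightarrow> carrier A \<Longrightarrow> f (finsum A F S) = (\<Sum>s\<in>S. f (F s))"
proof (induction S rule: infinite_finite_induct)
  case (insert s S)
  then show ?case by (subst finsum_insert) (auto simp: map_add)
qed (simp_all add: map_zero finsum_infinite)

end

section \<open>Embedding complex algebras into a type class algebra\<close>

text \<open>The product of all complex algebras whose carrier lies in a given type is an instance of
  \<^class>\<open>real_algebra\<close> containing each of them (non-unitally), so that identities can be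
  computed in a type class instead of relative to a carrier.\<close>

typedef 'a algebra_product =
  "{f :: (complex, 'a) module \<Rightarrow> 'a. \<forall>A. if complex_algebra A then f A \<in> carrier A else f A = undefined}"
  by (rule exI[of _ "\<lambda>A. if complex_algebra A then \<zero>\<^bsub>A\<^esub> else undefined"])
    (auto simp: complex_algebra_def ring.ring_simprules)

setup_lifting type_definition_algebra_product

lemma complex_algebra_ring: "complex_algebra A \<Longrightarrow> ring A"
  by (simp add: complex_algebra_def)

text \<open>In a coordinate that is not a complex algebra every element has the single value
  \<open>undefined\<close>, so each axiom holds there at once and has content only in the other
  coordinates.\<close>

instantiation algebra_product :: (type) real_algebra
begin

lift_definition zero_algebra_product :: "'a algebra_product"
  is "\<lambda>A. if complex_algebra A then \<zero>\<^bsub>A\<^esub> else undefined"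
  by (auto simp: complex_algebra_ring ring.ring_simprules)

lift_definition plus_algebra_product :: "'a algebra_product \<Rightarrow> 'a algebra_product \<Rightarrow> 'a algebra_product"
  is "\<lambda>f g A. if complex_algebra A then f A \<oplus>\<^bsub>A\<^esub> g A else undefined"
  by (metis complex_algebra_ring ring.ring_simprules(1))

lift_definition uminus_algebra_product :: "'a algebra_product \<Rightarrow> 'a algebra_product"
  is "\<lambda>f A. if complex_algebra A then \<ominus>\<^bsub>A\<^esub> f A else undefined"
  by (metis complex_algebra_ring ring.ring_simprules(3))

lift_definition minus_algebra_product :: "'a algebra_product \<Rightarrow> 'a algebra_product \<Rightarrow> 'a algebra_product"
  is "\<lambda>f g A. if complex_algebra A then f A \<ominus>\<^bsub>A\<^esub> g A else undefined"
  by (metis complex_algebra_ring ring.ring_simprules(4))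

lift_definition times_algebra_product :: "'a algebra_product \<Rightarrow> 'a algebra_product \<Rightarrow> 'a algebra_product"
  is "\<lambda>f g A. if complex_algebra A then f A \<otimes>\<^bsub>A\<^esub> g A else undefined"
  by (metis complex_algebra_ring ring.ring_simprules(5))

lift_definition scaleR_algebra_product :: "real \<Rightarrow> 'a algebra_product \<Rightarrow> 'a algebra_product"
  is "\<lambda>r f A. if complex_algebra A then complex_of_real r \<odot>\<^bsub>A\<^esub> f A else undefined"
  by (metis complex_algebra.smult_closed)

instance
proof
  fix p q r :: "'a algebra_product" and s t :: real
  show "p + q + r = p + (q + r)"
    by transfer (rule ext, simp, metis complex_algebra_ring ring.ring_simprules(7))
  show "p + q = q + p"
    by transfer (rule ext, simp, metis complex_algebra_ring ring.ring_simprules(10))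
  show "0 + p = p"
    by transfer (rule ext, simp, metis complex_algebra_ring ring.ring_simprules(8))
  show "- p + p = 0"
    by transfer (rule ext, simp, metis complex_algebra_ring ring.ring_simprules(9))
  show "p - q = p + - q"
    by transfer (rule ext, simp add: a_minus_def)
  show "p * q * r = p * (q * r)"
    by transfer (rule ext, simp, metis complex_algebra_ring ring.ring_simprules(11))
  show "(p + q) * r = p * r + q * r"
    by transfer (rule ext, simp, metis complex_algebra_ring ring.ring_simprules(13))
  show "p * (q + r) = p * q + p * r"
    by transfer (rule ext, simp, metis complex_algebra_ring ring.ring_simprules(23))
  show "s *\<^sub>R (p + q) = s *\<^sub>R p + s *\<^sub>R q"
    by transfer (rule ext, simp, metis complex_algebra.smult_add_right)
  show "(s + t) *\<^sub>R p = s *\<^sub>R p + t *\<^sub>R p"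
    by transfer (rule ext, simp, metis complex_algebra.smult_add_left)
  show "s *\<^sub>R t *\<^sub>R p = (s * t) *\<^sub>R p"
    by transfer (rule ext, simp, metis complex_algebra.smult_smult)
  show "1 *\<^sub>R p = p"
    by transfer (rule ext, simp, metis complex_algebra.smult_one)
  show "s *\<^sub>R p * q = s *\<^sub>R (p * q)"
    by transfer (rule ext, simp, metis complex_algebra.mult_smult_left)
  show "p * s *\<^sub>R q = s *\<^sub>R (p * q)"
    by transfer (rule ext, simp, metis complex_algebra.mult_smult_right)
qed

end

text \<open>Zero in all coordinates other than \<open>A\<close> makes the map additive and
  multiplicative, at the price of sending the unit to an idempotent.\<close>

lift_definition algebra_embed :: "(complex, 'a) module \<Rightarrow> 'a \<Rightarrow> 'a algebra_product"
  is "\<lambda>A a B. if complex_algebra B then if B = A \<and> a \<in> carrier A then a else \<zero>\<^bsub>B\<^esub> else undefined"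
  by (auto simp: complex_algebra_ring ring.ring_simprules)

lemma (in complex_algebra) smult_zero: "z \<odot> \<zero> = \<zero>"
  using smult_add_right[of \<zero> \<zero> z] by (metis add.r_cancel_one' r_zero smult_closed zero_closed)

lemma algebra_map_embed:
  assumes A: "complex_algebra A"
  shows "algebra_map A (algebra_embed A)"
proof -
  interpret complex_algebra A by (rule A)
  have 0: "ring B" if "complex_algebra B" for B :: "(complex, 'a) module"
    using that by (rule complex_algebra_ring)
  show ?thesis
  proof unfold_locales
    fix a b r assume a: "a \<in> carrier A" and b: "b \<in> carrier A"
    show "algebra_embed A (a \<oplus>\<^bsub>A\<^esub> b) = algebra_embed A a + algebra_embed A b"
      using a b by transfer (rule ext, auto simp: 0 ring.ring_simprules)
    show "algebra_embed A (a \<otimes>\<^bsub>A\<^esub> b) = algebra_embed A a * algebra_embed A b"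
      using a b by transfer (rule ext, auto simp: 0 ring.ring_simprules)
    show "algebra_embed A (complex_of_real r \<odot>\<^bsub>A\<^esub> a) = r *\<^sub>R algebra_embed A a"
      using a by transfer (rule ext, auto simp: complex_algebra.smult_zero complex_algebra.smult_closed)
  qed
qed

text \<open>The coordinate \<open>A\<close> returns the element. Through this lemma identities
  computed in the type class come back to the carrier.\<close>

lemma algebra_embed_inj:
  assumes "complex_algebra A" "a \<in> carrier A" "b \<in> carrier A" "algebra_embed A a = algebra_embed A b"
  shows "a = b"
  using assms(4,1-3) by transfer (metis (full_types))

section \<open>Monoid algebras, quotients and subalgebras\<close>

definition conv :: "('g, 'm) monoid_scheme \<Rightarrow> ('g \<Rightarrow>\<^sub>0 complex) \<Rightarrow> ('g \<Rightarrow>\<^sub>0 complex) \<Rightarrow> ('g \<Rightarrow>\<^sub>0 complex)" where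
  "conv G p q = (\<Sum>g\<in>Poly_Mapping.keys p. \<Sum>h\<in>Poly_Mapping.keys q.
     Poly_Mapping.single (g \<otimes>\<^bsub>G\<^esub> h) (Poly_Mapping.lookup p g * Poly_Mapping.lookup q h))"

lemma monoid_alg_simps [simp]:
  "carrier (monoid_alg G) = {p. Poly_Mapping.keys p \<subseteq> carrier G}"
  "mult (monoid_alg G) = conv G"
  "one (monoid_alg G) = Poly_Mapping.single \<one>\<^bsub>G\<^esub> 1"
  "zero (monoid_alg G) = 0"
  "add (monoid_alg G) = (+)"
  "smult (monoid_alg G) = (\<lambda>z p. Poly_Mapping.map ((*) z) p)"
  by (auto simp: monoid_alg_def conv_def fun_eq_iff)

text \<open>Added keys contribute coefficient 0. Enlarging the index sets is the way to
  biadditivity: keys of a sum may cancel, so the summands need one common index set.\<close>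

lemma conv_superset:
  assumes "finite K" "Poly_Mapping.keys p \<subseteq> K" "finite L" "Poly_Mapping.keys q \<subseteq> L"
  shows "conv G p q = (\<Sum>g\<in>K. \<Sum>h\<in>L.
     Poly_Mapping.single (g \<otimes>\<^bsub>G\<^esub> h) (Poly_Mapping.lookup p g * Poly_Mapping.lookup q h))"
proof -
  have "conv G p q = (\<Sum>g\<in>Poly_Mapping.keys p. \<Sum>h\<in>L.
     Poly_Mapping.single (g \<otimes>\<^bsub>G\<^esub> h) (Poly_Mapping.lookup p g * Poly_Mapping.lookup q h))"
    unfolding conv_def using assms
    by (intro sum.cong refl sum.mono_neutral_left) (auto simp: in_keys_iff)
  also have "\<dots> = (\<Sum>g\<in>K. \<Sum>h\<in>L.
     Poly_Mapping.single (g \<otimes>\<^bsub>G\<^esub> h) (Poly_Mapping.lookup p g * Poly_Mapping.lookup q h))"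
    using assms by (intro sum.mono_neutral_left) (auto simp: in_keys_iff)
  finally show ?thesis .
qed

lemma conv_add_left: "conv G (p + p') q = conv G p q + conv G p' q"
proof -
  let ?K = "Poly_Mapping.keys p \<union> Poly_Mapping.keys p'"
  have K: "finite ?K" "Poly_Mapping.keys p \<subseteq> ?K" "Poly_Mapping.keys p' \<subseteq> ?K" "Poly_Mapping.keys (p + p') \<subseteq> ?K"
    by (auto simp: Poly_Mapping.keys_add)
  show ?thesis
    by (simp add: conv_superset[OF K(1,2) finite_keys order_refl] conv_superset[OF K(1,3) finite_keys order_refl]
        conv_superset[OF K(1,4) finite_keys order_refl] lookup_add distrib_right single_add sum.distrib)
qed

lemma conv_add_right: "conv G p (q + q') = conv G p q + conv G p q'"
proof -
  let ?K = "Poly_Mapping.keys q \<union> Poly_Mapping.keys q'"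
  have K: "finite ?K" "Poly_Mapping.keys q \<subseteq> ?K" "Poly_Mapping.keys q' \<subseteq> ?K" "Poly_Mapping.keys (q + q') \<subseteq> ?K"
    by (auto simp: Poly_Mapping.keys_add)
  show ?thesis
    by (simp add: conv_superset[OF finite_keys order_refl K(1,2)] conv_superset[OF finite_keys order_refl K(1,3)]
        conv_superset[OF finite_keys order_refl K(1,4)] lookup_add distrib_left single_add sum.distrib)
qed

lemma conv_zero [simp]: "conv G 0 q = 0" "conv G p 0 = 0"
  by (simp_all add: conv_def)

lemma conv_sum_left: "conv G (\<Sum>i\<in>S. F i) q = (\<Sum>i\<in>S. conv G (F i) q)"
  by (induction S rule: infinite_finite_induct) (simp_all add: conv_add_left)

lemma conv_sum_right: "conv G p (\<Sum>i\<in>S. F i) = (\<Sum>i\<in>S. conv G p (F i))"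
  by (induction S rule: infinite_finite_induct) (simp_all add: conv_add_right)

lemma conv_single [simp]:
  "conv G (Poly_Mapping.single g u) (Poly_Mapping.single h v) = Poly_Mapping.single (g \<otimes>\<^bsub>G\<^esub> h) (u * v)"
  by (simp add: conv_superset[of "{g}" _ "{h}"])

lemma sum_single_keys: "(\<Sum>g\<in>Poly_Mapping.keys p. Poly_Mapping.single g (Poly_Mapping.lookup p g)) = p"
proof (rule poly_mapping_eqI)
  fix k
  show "Poly_Mapping.lookup (\<Sum>g\<in>Poly_Mapping.keys p. Poly_Mapping.single g (Poly_Mapping.lookup p g)) k
    = Poly_Mapping.lookup p k"
    by (simp add: lookup_sum lookup_single when_def in_keys_iff)
qed

lemma map_smult_single [simp]:
  "Poly_Mapping.map ((*) z) (Poly_Mapping.single g u) = Poly_Mapping.single g (z * (u::complex))"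
  by (rule poly_mapping_eqI) (simp add: map.rep_eq lookup_single when_def)

lemma lookup_map_smult: "Poly_Mapping.lookup (Poly_Mapping.map ((*) z) p) k = (z::complex) * Poly_Mapping.lookup p k"
  by (simp add: map.rep_eq when_def)

lemma map_smult_add: "Poly_Mapping.map ((*) z) (p + q) = Poly_Mapping.map ((*) z) p + Poly_Mapping.map ((*) (z::complex)) q"
  by (rule poly_mapping_eqI) (simp add: lookup_map_smult lookup_add distrib_left)

lemma keys_conv: "Poly_Mapping.keys (conv G p q) \<subseteq>
   (\<lambda>(g, h). g \<otimes>\<^bsub>G\<^esub> h) ` (Poly_Mapping.keys p \<times> Poly_Mapping.keys q)"
proof
  fix k assume "k \<in> Poly_Mapping.keys (conv G p q)"
  then have nz: "Poly_Mapping.lookup (conv G p q) k \<noteq> 0" by (simp add: in_keys_iff)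
  have "\<exists>g\<in>Poly_Mapping.keys p. \<exists>h\<in>Poly_Mapping.keys q. k = g \<otimes>\<^bsub>G\<^esub> h"
  proof (rule ccontr)
    assume "\<not> ?thesis"
    then have "Poly_Mapping.lookup (conv G p q) k = 0"
      unfolding conv_def lookup_sum by (intro sum.neutral ballI) (auto simp: lookup_single when_def)
    with nz show False by simp
  qed
  then show "k \<in> (\<lambda>(g, h). g \<otimes>\<^bsub>G\<^esub> h) ` (Poly_Mapping.keys p \<times> Poly_Mapping.keys q)"
    by auto
qed

lemma conv_assoc:
  assumes "monoid G" "Poly_Mapping.keys p \<subseteq> carrier G" "Poly_Mapping.keys q \<subseteq> carrier G"
    "Poly_Mapping.keys r \<subseteq> carrier G"
  shows "conv G (conv G p q) r = conv G p (conv G q r)"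
proof -
  interpret monoid G by fact
  have *: "conv G (conv G (Poly_Mapping.single g u) (Poly_Mapping.single h v)) (Poly_Mapping.single k w)
     = conv G (Poly_Mapping.single g u) (conv G (Poly_Mapping.single h v) (Poly_Mapping.single k w))"
    if "g \<in> carrier G" "h \<in> carrier G" "k \<in> carrier G" for g h k u v w
    using that by (simp add: m_assoc mult.assoc)
  show ?thesis
    \<comment> \<open>Biadditivity reduces the claim to basis vectors, where it is associativity in
      \<open>G\<close>.\<close>
    apply (subst (1 2) sum_single_keys[of p, symmetric])
    apply (subst (1 2) sum_single_keys[of q, symmetric])
    apply (subst (1 2) sum_single_keys[of r, symmetric])
    apply (simp only: conv_sum_left conv_sum_right)
    using assms by (intro sum.cong refl *) auto
qed

text \<open>Stated for every multiple of the unit: scaling becomes a convolution, and its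
  compatibility with products turns into an instance of \<open>conv_assoc\<close>.\<close>

lemma conv_one:
  assumes "monoid G" "Poly_Mapping.keys p \<subseteq> carrier G"
  shows "conv G (Poly_Mapping.single \<one>\<^bsub>G\<^esub> z) p = Poly_Mapping.map ((*) z) p"
    "conv G p (Poly_Mapping.single \<one>\<^bsub>G\<^esub> z) = Poly_Mapping.map ((*) z) p"
proof -
  interpret monoid G by fact
  have m: "Poly_Mapping.map ((*) z) p
    = (\<Sum>g\<in>Poly_Mapping.keys p. Poly_Mapping.single g (z * Poly_Mapping.lookup p g))"
    by (rule poly_mapping_eqI) (simp add: lookup_map_smult lookup_sum lookup_single when_def in_keys_iff)
  show "conv G (Poly_Mapping.single \<one>\<^bsub>G\<^esub> z) p = Poly_Mapping.map ((*) z) p"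
    unfolding m using assms
    by (subst sum_single_keys[of p, symmetric], simp only: conv_sum_right) (auto intro!: sum.cong)
  show "conv G p (Poly_Mapping.single \<one>\<^bsub>G\<^esub> z) = Poly_Mapping.map ((*) z) p"
    unfolding m using assms
    by (subst sum_single_keys[of p, symmetric], simp only: conv_sum_left) (auto intro!: sum.cong simp: mult.commute)
qed

lemma map_smult_one: "Poly_Mapping.map ((*) (1::complex)) p = p"
  by (rule poly_mapping_eqI) (simp add: lookup_map_smult)

lemma complex_algebra_monoid_alg:
  assumes "monoid G"
  shows "complex_algebra (monoid_alg G)"
proof -
  interpret monoid G by fact
  have keys_map: "Poly_Mapping.keys (Poly_Mapping.map ((*) z) p) \<subseteq> Poly_Mapping.keys p" for z :: complex and p :: "'a \<Rightarrow>\<^sub>0 complex"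
    by (auto simp: in_keys_iff lookup_map_smult)
  have keys_cl: "Poly_Mapping.keys (conv G p q) \<subseteq> carrier G"
    if "Poly_Mapping.keys p \<subseteq> carrier G" "Poly_Mapping.keys q \<subseteq> carrier G" for p q
    using keys_conv[of G p q] that by fastforce
  have keys_plus: "Poly_Mapping.keys (p + q) \<subseteq> carrier G"
    if "Poly_Mapping.keys p \<subseteq> carrier G" "Poly_Mapping.keys q \<subseteq> carrier G" for p q :: "'a \<Rightarrow>\<^sub>0 complex"
    using Poly_Mapping.keys_add[of p q] that by blast
  have c1: "conv G (Poly_Mapping.map ((*) z) p) q = Poly_Mapping.map ((*) z) (conv G p q)"
    if "Poly_Mapping.keys p \<subseteq> carrier G" "Poly_Mapping.keys q \<subseteq> carrier G" for z p q
    using that conv_assoc[OF assms _ that, of "Poly_Mapping.single \<one>\<^bsub>G\<^esub> z"] conv_one(1)[OF assms]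
    by (simp add: keys_cl)
  have c2: "conv G p (Poly_Mapping.map ((*) z) q) = Poly_Mapping.map ((*) z) (conv G p q)"
    if "Poly_Mapping.keys p \<subseteq> carrier G" "Poly_Mapping.keys q \<subseteq> carrier G" for z p q
    using that conv_assoc[OF assms that, of "Poly_Mapping.single \<one>\<^bsub>G\<^esub> z"] conv_one(2)[OF assms]
    by (simp add: keys_cl)
  have ring: "ring (monoid_alg G)"
  proof (rule ringI)
    show "abelian_group (monoid_alg G)"
    proof (rule abelian_groupI)
      fix p assume p: "p \<in> carrier (monoid_alg G)"
      show "\<exists>q\<in>carrier (monoid_alg G). q \<oplus>\<^bsub>monoid_alg G\<^esub> p = \<zero>\<^bsub>monoid_alg G\<^esub>"
        using p by (intro bexI[of _ "- p"]) (auto simp: in_keys_iff)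
    qed (auto simp: ac_simps keys_plus[THEN subsetD])
    show "Group.monoid (monoid_alg G)"
      by (rule monoidI) (auto simp: keys_cl[THEN subsetD] conv_assoc[OF assms] conv_one[OF assms] map_smult_one split: if_splits)
  qed (auto simp: conv_add_left conv_add_right)
  show ?thesis
  proof (intro complex_algebra.intro ring complex_algebra_axioms.intro)
    fix z w :: complex and p assume "p \<in> carrier (monoid_alg G)"
    show "z \<odot>\<^bsub>monoid_alg G\<^esub> p \<in> carrier (monoid_alg G)"
      using \<open>p \<in> _\<close> keys_map[of z p] by auto
    show "(z + w) \<odot>\<^bsub>monoid_alg G\<^esub> p = z \<odot>\<^bsub>monoid_alg G\<^esub> p \<oplus>\<^bsub>monoid_alg G\<^esub> w \<odot>\<^bsub>monoid_alg G\<^esub> p"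
      "z \<odot>\<^bsub>monoid_alg G\<^esub> (w \<odot>\<^bsub>monoid_alg G\<^esub> p) = (z * w) \<odot>\<^bsub>monoid_alg G\<^esub> p"
      by (auto intro!: poly_mapping_eqI simp: lookup_map_smult lookup_add distrib_right)
    show "1 \<odot>\<^bsub>monoid_alg G\<^esub> p = p"
      by (simp add: map_smult_one)
    fix q assume "q \<in> carrier (monoid_alg G)"
    show "z \<odot>\<^bsub>monoid_alg G\<^esub> (p \<oplus>\<^bsub>monoid_alg G\<^esub> q) = z \<odot>\<^bsub>monoid_alg G\<^esub> p \<oplus>\<^bsub>monoid_alg G\<^esub> z \<odot>\<^bsub>monoid_alg G\<^esub> q"
      by (simp add: map_smult_add)
    show "z \<odot>\<^bsub>monoid_alg G\<^esub> p \<otimes>\<^bsub>monoid_alg G\<^esub> q = z \<odot>\<^bsub>monoid_alg G\<^esub> (p \<otimes>\<^bsub>monoid_alg G\<^esub> q)"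
      "p \<otimes>\<^bsub>monoid_alg G\<^esub> (z \<odot>\<^bsub>monoid_alg G\<^esub> q) = z \<odot>\<^bsub>monoid_alg G\<^esub> (p \<otimes>\<^bsub>monoid_alg G\<^esub> q)"
      using \<open>p \<in> _\<close> \<open>q \<in> _\<close> by (simp_all add: c1 c2)
  qed
qed

text \<open>The quotient ring formed by \<open>Quot\<close> has no scalar field in its record, so
  its ring laws have to be carried over to the record \<open>quot_alg\<close>.\<close>

lemma ring_cong:
  assumes "ring A" "carrier B = carrier A" "mult B = mult A" "one B = one A" "zero B = zero A" "add B = add A"
  shows "ring B"
proof -
  interpret A: ring A by fact
  show ?thesis
  proof (intro ringI abelian_groupI monoidI; unfold assms(2-6))
    fix a assume "a \<in> carrier A"
    then show "\<exists>b\<in>carrier A. b \<oplus>\<^bsub>A\<^esub> a = \<zero>\<^bsub>A\<^esub>"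
      by (intro bexI[of _ "\<ominus>\<^bsub>A\<^esub> a"]) (auto simp: A.l_neg)
  qed (auto simp: A.ring_simprules)
qed

section \<open>Quotient algebras and generated subalgebras\<close>

lemma quot_alg_simps:
  "carrier (quot_alg A S) = carrier (A Quot Idl\<^bsub>A\<^esub> S)"
  "mult (quot_alg A S) = mult (A Quot Idl\<^bsub>A\<^esub> S)"
  "one (quot_alg A S) = one (A Quot Idl\<^bsub>A\<^esub> S)"
  "zero (quot_alg A S) = zero (A Quot Idl\<^bsub>A\<^esub> S)"
  "add (quot_alg A S) = add (A Quot Idl\<^bsub>A\<^esub> S)"
  "smult (quot_alg A S) = (\<lambda>z X. \<Union>a\<in>X. quot_proj A S (z \<odot>\<^bsub>A\<^esub> a))"
  by (simp_all add: quot_alg_def Let_def)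

locale algebra_quotient = complex_algebra A for A :: "(complex, 'a) module" (structure) +
  fixes S :: "'a set"
  assumes S_closed: "S \<subseteq> carrier A"
begin

abbreviation "Q \<equiv> quot_alg A S"
abbreviation "\<pi> \<equiv> quot_proj A S"

lemma ideal_S: "ideal (Idl S) A"
  by (rule genideal_ideal) (rule S_closed)

lemma carrier_Q: "carrier Q = \<pi> ` carrier A"
  by (auto simp: quot_alg_simps quot_proj_def FactRing_def A_RCOSETS_def')

lemma proj_closed [simp]: "a \<in> carrier A \<Longrightarrow> \<pi> a \<in> carrier Q"
  by (simp add: carrier_Q)

lemma proj_hom: "\<pi> \<in> ring_hom A Q"
  using ideal.rcos_ring_hom[OF ideal_S]
  by (simp add: ring_hom_def quot_alg_simps quot_proj_def[abs_def])

lemma proj_mult: "a \<in> carrier A \<Longrightarrow> b \<in> carrier A \<Longrightarrow> \<pi> (a \<otimes> b) = \<pi> a \<otimes>\<^bsub>Q\<^esub> \<pi> b"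
  using ring_hom_mult[OF proj_hom] .

lemma proj_add: "a \<in> carrier A \<Longrightarrow> b \<in> carrier A \<Longrightarrow> \<pi> (a \<oplus> b) = \<pi> a \<oplus>\<^bsub>Q\<^esub> \<pi> b"
  using ring_hom_add[OF proj_hom] .

lemma proj_one: "\<pi> \<one> = \<one>\<^bsub>Q\<^esub>"
  using ring_hom_one[OF proj_hom] .

lemma ring_Q: "ring Q"
  by (rule ring_cong[OF ideal.quotient_is_ring[OF ideal_S]]) (simp_all add: quot_alg_simps)

lemma proj_ideal: "a \<in> Idl S \<Longrightarrow> \<pi> a = \<zero>\<^bsub>Q\<^esub>"
  using ideal_S abelian_group.a_coset_join2[OF abelian_group_axioms _ additive_subgroup.a_subgroup]
  unfolding quot_proj_def quot_alg_simps FactRing_def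
  by (simp add: ideal.axioms(1) ideal.Icarr)

lemma proj_rel: "a \<in> S \<Longrightarrow> \<pi> a = \<zero>\<^bsub>Q\<^esub>"
  using genideal_self[OF S_closed] by (intro proj_ideal) auto

text \<open>The union that defines scaling of cosets collapses to one coset: for \<open>h\<close> in
  the ideal, \<open>z \<odot> h\<close> is the product of \<open>z \<odot> \<one>\<close> with
  \<open>h\<close>, so it stays in the ideal and the choice of representative does not
  matter.\<close>

lemma proj_smult:
  assumes a: "a \<in> carrier A"
  shows "\<pi> (z \<odot> a) = z \<odot>\<^bsub>Q\<^esub> \<pi> a"
proof -
  interpret I: ideal "Idl S" A by (rule ideal_S)
  interpret Q: ring Q by (rule ring_Q)
  have const: "\<pi> (z \<odot> b) = \<pi> (z \<odot> a)" if b: "b \<in> \<pi> a" for b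
  proof -
    obtain h where h: "h \<in> Idl S" "b = h \<oplus> a"
      using b unfolding quot_proj_def a_r_coset_def' by auto
    have hc: "h \<in> carrier A" using h by (simp add: I.a_Hcarr)
    have "z \<odot> h = (z \<odot> \<one>) \<otimes> h" using hc by (simp add: mult_smult_left)
    then have "z \<odot> h \<in> Idl S" using I.I_l_closed[OF h(1)] by simp
    then show ?thesis
      using a hc by (simp add: h smult_add_right proj_add proj_ideal)
  qed
  have "a \<in> \<pi> a"
    unfolding quot_proj_def by (rule I.a_rcos_self[OF a])
  moreover have "z \<odot>\<^bsub>Q\<^esub> \<pi> a = (\<Union>b\<in>\<pi> a. \<pi> (z \<odot> a))"
    unfolding quot_alg_simps by (rule SUP_cong[OF refl const])
  ultimately show ?thesis by blast
qed

lemma complex_algebra_Q: "complex_algebra Q"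
proof (intro complex_algebra.intro ring_Q complex_algebra_axioms.intro)
qed (auto simp: carrier_Q proj_smult[symmetric] proj_add[symmetric] proj_mult[symmetric] smult_add_left smult_add_right smult_smult smult_one
   mult_smult_left mult_smult_right)

lemma proj_minus:
  assumes "a \<in> carrier A" "b \<in> carrier A"
  shows "\<pi> (a \<ominus> b) = \<pi> a \<ominus>\<^bsub>Q\<^esub> \<pi> b"
proof -
  interpret Q: complex_algebra Q by (rule complex_algebra_Q)
  show ?thesis using assms
    by (simp add: minus_eq_smult Q.minus_eq_smult proj_add proj_smult)
qed

lemma proj_eqI: "a \<in> carrier A \<Longrightarrow> b \<in> carrier A \<Longrightarrow> a \<ominus> b \<in> S \<Longrightarrow> \<pi> a = \<pi> b"
proof -
  assume *: "a \<in> carrier A" "b \<in> carrier A" "a \<ominus> b \<in> S"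
  interpret Q: ring Q by (rule ring_Q)
  show ?thesis
    using proj_rel[OF *(3)] * by (simp add: proj_minus)
qed

end

text \<open>The multiples of the unit are among the ring generators, and multiplying by them gives
  closure under scalars.\<close>

lemma complex_algebra_generated:
  assumes "complex_algebra A" "S \<subseteq> carrier A"
  shows "complex_algebra (subalgebra_generated A S)"
proof -
  interpret complex_algebra A by fact
  define H where "H = range (\<lambda>z. z \<odot>\<^bsub>A\<^esub> \<one>\<^bsub>A\<^esub>) \<union> S"
  have H: "H \<subseteq> carrier A" using assms by (auto simp: H_def)
  note in_carrier = generate_ring_in_carrier[OF H]
  have "z \<odot>\<^bsub>A\<^esub> a \<in> generate_ring A H" if "a \<in> generate_ring A H" for z a
  proof -
    have "(z \<odot>\<^bsub>A\<^esub> \<one>\<^bsub>A\<^esub>) \<otimes>\<^bsub>A\<^esub> a \<in> generate_ring A H"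
      by (rule generate_ring.eng_mult[OF generate_ring.incl that]) (auto simp: H_def)
    then show ?thesis using in_carrier[OF that] by (simp add: mult_smult_left)
  qed
  then show ?thesis
    unfolding subalgebra_generated_def H_def[symmetric]
    by (intro complex_algebra.intro generate_ring_is_ring[OF H] complex_algebra_axioms.intro)
      (auto dest!: in_carrier simp: smult_add_left smult_add_right smult_smult smult_one
        mult_smult_left mult_smult_right)
qed

text \<open>The defining relations are written with subtraction of finitely supported functions,
  while \<open>proj_eqI\<close> speaks of subtraction in the ring record.\<close>

lemma monoid_alg_minus:
  assumes "monoid G" "p \<in> carrier (monoid_alg G)" "q \<in> carrier (monoid_alg G)"
  shows "p \<ominus>\<^bsub>monoid_alg G\<^esub> q = p - q"
proof -
  interpret complex_algebra "monoid_alg G" by (rule complex_algebra_monoid_alg) fact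
  have "p \<ominus>\<^bsub>monoid_alg G\<^esub> q = p + Poly_Mapping.map ((*) (-1)) q"
    using minus_eq_smult[OF assms(2,3)] by simp
  then show ?thesis
    by (intro poly_mapping_eqI) (simp add: lookup_add lookup_minus lookup_map_smult)
qed

lemma single_in_monoid_alg: "g \<in> carrier G \<Longrightarrow> Poly_Mapping.single g z \<in> carrier (monoid_alg G)"
  by simp

lemma diff_in_monoid_alg:
  assumes "monoid G" "p \<in> carrier (monoid_alg G)" "q \<in> carrier (monoid_alg G)"
  shows "p - q \<in> carrier (monoid_alg G)"
proof -
  interpret complex_algebra "monoid_alg G" by (rule complex_algebra_monoid_alg) fact
  show ?thesis using minus_closed[OF assms(2,3)] monoid_alg_minus[OF assms] by simp
qed

lemma add_in_monoid_alg:
  assumes "monoid G" "p \<in> carrier (monoid_alg G)" "q \<in> carrier (monoid_alg G)"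
  shows "p + q \<in> carrier (monoid_alg G)"
proof -
  interpret complex_algebra "monoid_alg G" by (rule complex_algebra_monoid_alg) fact
  show ?thesis using add.m_closed[OF assms(2,3)] by simp
qed

section \<open>Tensor products\<close>

locale algebra_tensor = A: complex_algebra A + B: complex_algebra B
  for A :: "(complex, 'a) module" (structure) and B :: "(complex, 'b) module" (structure)
begin

abbreviation "T \<equiv> tensor_alg A B"
abbreviation "tensor \<equiv> pure_tensor A B"

lemma monoid_AB: "monoid (A \<times>\<times> B)"
  by (rule DirProd_monoid) (rule A.monoid_axioms, rule B.monoid_axioms)

lemma quotient: "algebra_quotient (monoid_alg (A \<times>\<times> B)) (bilin_rels A B)"
proof (intro algebra_quotient.intro algebra_quotient_axioms.intro complex_algebra_monoid_alg monoid_AB)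
  show "bilin_rels A B \<subseteq> carrier (monoid_alg (A \<times>\<times> B))"
    unfolding bilin_rels_def
    by (auto intro!: diff_in_monoid_alg[OF monoid_AB] single_in_monoid_alg simp del: monoid_alg_simps)
qed

sublocale Q: algebra_quotient "monoid_alg (A \<times>\<times> B)" "bilin_rels A B"
  by (rule quotient)

lemma complex_algebra_T: "complex_algebra T"
  unfolding tensor_alg_def by (rule Q.complex_algebra_Q)

lemma tensor_closed: "a \<in> carrier A \<Longrightarrow> b \<in> carrier B \<Longrightarrow> tensor a b \<in> carrier T"
  unfolding tensor_alg_def pure_tensor_def by (rule Q.proj_closed) simp

lemma tensor_mult:
  assumes "a \<in> carrier A" "b \<in> carrier B" "a' \<in> carrier A" "b' \<in> carrier B"
  shows "tensor a b \<otimes>\<^bsub>T\<^esub> tensor a' b' = tensor (a \<otimes>\<^bsub>A\<^esub> a') (b \<otimes>\<^bsub>B\<^esub> b')"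
  using assms unfolding tensor_alg_def pure_tensor_def
  by (subst Q.proj_mult[symmetric]) simp_all

lemma proj_diff_eqI:
  assumes "p \<in> carrier (monoid_alg (A \<times>\<times> B))" "q \<in> carrier (monoid_alg (A \<times>\<times> B))" "p - q \<in> bilin_rels A B"
  shows "quot_proj (monoid_alg (A \<times>\<times> B)) (bilin_rels A B) p = quot_proj (monoid_alg (A \<times>\<times> B)) (bilin_rels A B) q"
  using assms Q.proj_eqI monoid_alg_minus[OF monoid_AB] by metis

lemma tensor_add_left:
  assumes "a \<in> carrier A" "a' \<in> carrier A" "b \<in> carrier B"
  shows "tensor (a \<oplus>\<^bsub>A\<^esub> a') b = tensor a b \<oplus>\<^bsub>T\<^esub> tensor a' b"
proof -
  have "tensor (a \<oplus>\<^bsub>A\<^esub> a') b = quot_proj (monoid_alg (A \<times>\<times> B)) (bilin_rels A B)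
      (Poly_Mapping.single (a, b) 1 + Poly_Mapping.single (a', b) 1)"
    unfolding pure_tensor_def
    by (intro proj_diff_eqI add_in_monoid_alg[OF monoid_AB] single_in_monoid_alg)
      (use assms in \<open>auto simp: bilin_rels_def diff_diff_eq[symmetric]\<close>)
  then show ?thesis
    using Q.proj_add[of "Poly_Mapping.single (a, b) 1" "Poly_Mapping.single (a', b) 1"] assms
    unfolding tensor_alg_def pure_tensor_def by simp
qed

lemma tensor_add_right:
  assumes "a \<in> carrier A" "b \<in> carrier B" "b' \<in> carrier B"
  shows "tensor a (b \<oplus>\<^bsub>B\<^esub> b') = tensor a b \<oplus>\<^bsub>T\<^esub> tensor a b'"
proof -
  have "tensor a (b \<oplus>\<^bsub>B\<^esub> b') = quot_proj (monoid_alg (A \<times>\<times> B)) (bilin_rels A B)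
      (Poly_Mapping.single (a, b) 1 + Poly_Mapping.single (a, b') 1)"
    unfolding pure_tensor_def
    by (intro proj_diff_eqI add_in_monoid_alg[OF monoid_AB] single_in_monoid_alg)
      (use assms in \<open>auto simp: bilin_rels_def diff_diff_eq[symmetric]\<close>)
  then show ?thesis
    using Q.proj_add[of "Poly_Mapping.single (a, b) 1" "Poly_Mapping.single (a, b') 1"] assms
    unfolding tensor_alg_def pure_tensor_def by simp
qed

lemma proj_single:
  assumes "a \<in> carrier A" "b \<in> carrier B"
  shows "quot_proj (monoid_alg (A \<times>\<times> B)) (bilin_rels A B) (Poly_Mapping.single (a, b) z)
    = z \<odot>\<^bsub>T\<^esub> tensor a b"
  using Q.proj_smult[of "Poly_Mapping.single (a, b) 1" z] assms
  unfolding tensor_alg_def pure_tensor_def by simp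

lemma tensor_smult_left:
  assumes "a \<in> carrier A" "b \<in> carrier B"
  shows "tensor (z \<odot>\<^bsub>A\<^esub> a) b = z \<odot>\<^bsub>T\<^esub> tensor a b"
  unfolding proj_single[OF assms, symmetric] unfolding pure_tensor_def
  by (intro proj_diff_eqI single_in_monoid_alg) (use assms in \<open>auto simp: bilin_rels_def\<close>)

lemma tensor_smult_right:
  assumes "a \<in> carrier A" "b \<in> carrier B"
  shows "tensor a (z \<odot>\<^bsub>B\<^esub> b) = z \<odot>\<^bsub>T\<^esub> tensor a b"
  unfolding proj_single[OF assms, symmetric] unfolding pure_tensor_def
  by (intro proj_diff_eqI single_in_monoid_alg) (use assms in \<open>auto simp: bilin_rels_def\<close>)

lemma algebra_map_left:
  "algebra_map A (\<lambda>a. algebra_embed T (tensor a \<one>\<^bsub>B\<^esub>))"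
proof -
  interpret E: algebra_map T "algebra_embed T" by (rule algebra_map_embed[OF complex_algebra_T])
  show ?thesis
    by unfold_locales
      (simp_all add: tensor_add_left E.map_add E.map_mult[symmetric] tensor_closed tensor_mult
        tensor_smult_left E.map_smult)
qed

lemma algebra_map_right:
  "algebra_map B (\<lambda>b. algebra_embed T (tensor \<one>\<^bsub>A\<^esub> b))"
proof -
  interpret E: algebra_map T "algebra_embed T" by (rule algebra_map_embed[OF complex_algebra_T])
  show ?thesis
    by unfold_locales
      (simp_all add: tensor_add_right E.map_add E.map_mult[symmetric] tensor_closed tensor_mult
        tensor_smult_right E.map_smult)
qed

text \<open>Pure tensors thus split into commuting factors, which is the shape of the hypotheses
  \<open>\<gamma>M\<close> and \<open>\<gamma>s\<close>.\<close>

lemma embed_tensor: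
  assumes "a \<in> carrier A" "b \<in> carrier B"
  shows "algebra_embed T (tensor a \<one>\<^bsub>B\<^esub>) * algebra_embed T (tensor \<one>\<^bsub>A\<^esub> b) = algebra_embed T (tensor a b)"
    and "algebra_embed T (tensor \<one>\<^bsub>A\<^esub> b) * algebra_embed T (tensor a \<one>\<^bsub>B\<^esub>) = algebra_embed T (tensor a b)"
proof -
  interpret E: algebra_map T "algebra_embed T" by (rule algebra_map_embed[OF complex_algebra_T])
  show "algebra_embed T (tensor a \<one>\<^bsub>B\<^esub>) * algebra_embed T (tensor \<one>\<^bsub>A\<^esub> b) = algebra_embed T (tensor a b)"
    and "algebra_embed T (tensor \<one>\<^bsub>A\<^esub> b) * algebra_embed T (tensor a \<one>\<^bsub>B\<^esub>) = algebra_embed T (tensor a b)"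
    using assms by (simp_all add: E.map_mult[symmetric] tensor_closed tensor_mult)
qed

end

section \<open>Clifford algebra\<close>

lemma monoid_free: "monoid (free_monoid G)"
  by (rule monoidI) (auto simp: free_monoid_def)

lemma single_in_free_alg: "set xs \<subseteq> G \<Longrightarrow> Poly_Mapping.single xs z \<in> carrier (monoid_alg (free_monoid G))"
  by (intro single_in_monoid_alg) (auto simp: free_monoid_def)

lemma clifford_rel_closed:
  assumes "i \<in> {1..n}" "j \<in> {1..n}"
  shows "Poly_Mapping.single [i, j] 1 + Poly_Mapping.single [j, i] 1 \<in> carrier (monoid_alg (free_monoid {1..n}))"
    "Poly_Mapping.single [] z \<in> carrier (monoid_alg (free_monoid {1..n}))"
  using assms
  by (intro add_in_monoid_alg[OF monoid_free single_in_free_alg single_in_free_alg], simp, simp)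
    (rule single_in_free_alg, simp)

lemma clifford_quotient: "algebra_quotient (monoid_alg (free_monoid {1..n})) (clifford_rels n)"
proof (intro algebra_quotient.intro algebra_quotient_axioms.intro complex_algebra_monoid_alg monoid_free)
  show "clifford_rels n \<subseteq> carrier (monoid_alg (free_monoid {1..n}))"
  proof
    fix p assume "p \<in> clifford_rels n"
    then obtain i j where ij: "i \<in> {1..n}" "j \<in> {1..n}" and p: "p = Poly_Mapping.single [i, j] 1
        + Poly_Mapping.single [j, i] 1 - Poly_Mapping.single [] (if i = j then 2 else 0)"
      unfolding clifford_rels_def by blast
    show "p \<in> carrier (monoid_alg (free_monoid {1..n}))"
      unfolding p by (rule diff_in_monoid_alg[OF monoid_free clifford_rel_closed[OF ij]])
  qed
qed

lemma complex_algebra_clifford: "complex_algebra (clifford n)"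
  unfolding clifford_def by (rule algebra_quotient.complex_algebra_Q[OF clifford_quotient])

lemma cliff_gen_closed: "i \<in> {1..n} \<Longrightarrow> cliff_gen n i \<in> carrier (clifford n)"
  unfolding clifford_def cliff_gen_def
  by (rule algebra_quotient.proj_closed[OF clifford_quotient]) (simp add: free_monoid_def)

lemma cliff_gen_anticommute:
  assumes ij: "i \<in> {1..n}" "j \<in> {1..n}"
  shows "cliff_gen n i \<otimes>\<^bsub>clifford n\<^esub> cliff_gen n j \<oplus>\<^bsub>clifford n\<^esub> cliff_gen n j \<otimes>\<^bsub>clifford n\<^esub> cliff_gen n i
    = (if i = j then 2 else 0) \<odot>\<^bsub>clifford n\<^esub> \<one>\<^bsub>clifford n\<^esub>"
proof -
  interpret Q: algebra_quotient "monoid_alg (free_monoid {1..n})" "clifford_rels n"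
    by (rule clifford_quotient)
  define r :: complex where "r = (if i = j then 2 else 0)"
  have s: "Poly_Mapping.single xs z \<in> carrier (monoid_alg (free_monoid {1..n}))" if "set xs \<subseteq> {1..n}" for xs z
    using that by (rule single_in_free_alg)
  note [simp del] = monoid_alg_simps(1)
  have "Q.\<pi> (Poly_Mapping.single [i, j] 1 + Poly_Mapping.single [j, i] 1) = Q.\<pi> (Poly_Mapping.single [] r)"
  proof (rule Q.proj_eqI[OF clifford_rel_closed[OF ij]])
    show "Poly_Mapping.single [i, j] 1 + Poly_Mapping.single [j, i] 1
        \<ominus>\<^bsub>monoid_alg (free_monoid {1..n})\<^esub> Poly_Mapping.single [] r \<in> clifford_rels n"
      unfolding monoid_alg_minus[OF monoid_free clifford_rel_closed[OF ij]]
      unfolding clifford_rels_def r_def using ij by blast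
  qed
  also have "Q.\<pi> (Poly_Mapping.single [] r) = r \<odot>\<^bsub>clifford n\<^esub> \<one>\<^bsub>clifford n\<^esub>"
    using Q.proj_smult[OF Q.one_closed, of r] Q.proj_one
    by (simp add: clifford_def free_monoid_def)
  also have "Q.\<pi> (Poly_Mapping.single [i, j] 1 + Poly_Mapping.single [j, i] 1)
    = Q.\<pi> (Poly_Mapping.single [i, j] 1) \<oplus>\<^bsub>clifford n\<^esub> Q.\<pi> (Poly_Mapping.single [j, i] 1)"
    using Q.proj_add[OF s s, of "[i, j]" "[j, i]" 1 1] ij by (simp add: clifford_def)
  also have "Q.\<pi> (Poly_Mapping.single [i, j] 1) = cliff_gen n i \<otimes>\<^bsub>clifford n\<^esub> cliff_gen n j"
    using Q.proj_mult[OF s s, of "[i]" "[j]" 1 1] ij by (simp add: clifford_def cliff_gen_def free_monoid_def)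
  also have "Q.\<pi> (Poly_Mapping.single [j, i] 1) = cliff_gen n j \<otimes>\<^bsub>clifford n\<^esub> cliff_gen n i"
    using Q.proj_mult[OF s s, of "[j]" "[i]" 1 1] ij by (simp add: clifford_def cliff_gen_def free_monoid_def)
  finally show ?thesis unfolding r_def .
qed

section \<open>Reflections and the smash product\<close>

lemma group_orthogonal_group: "group (orthogonal_group :: ('e::euclidean_space \<Rightarrow> 'e) monoid)"
proof (rule groupI)
  fix f :: "'e \<Rightarrow> 'e" assume "f \<in> carrier orthogonal_group"
  then have f: "orthogonal_transformation f" by (simp add: orthogonal_group_def)
  show "\<exists>g\<in>carrier orthogonal_group. g \<otimes>\<^bsub>orthogonal_group\<^esub> f = \<one>\<^bsub>orthogonal_group\<^esub>"
    using f orthogonal_transformation_inv[OF f] orthogonal_transformation_inj[OF f]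
    by (intro bexI[of _ "inv_into UNIV f"]) (auto simp: orthogonal_group_def)
qed (auto simp: orthogonal_group_def id_def o_assoc
    intro: orthogonal_transformation_compose)

lemma blinfun_apply_riesz: "blinfun_apply \<alpha> v = riesz \<alpha> \<bullet> v"
proof -
  have "blinfun_apply \<alpha> v = blinfun_apply \<alpha> (\<Sum>b\<in>Basis. (v \<bullet> b) *\<^sub>R b)"
    by (simp add: euclidean_representation)
  then show ?thesis
    by (simp add: riesz_def blinfun.sum_right blinfun.scaleR_right inner_sum_left inner_commute[of v] mult.commute)
qed

lemma orthogonal_root_refl: "orthogonal_transformation (root_refl \<alpha>)"
  unfolding orthogonal_transformation_def
proof (intro conjI allI)
  show "linear (root_refl \<alpha>)"
    by (rule linearI) (simp_all add: root_refl_def blinfun.add_right blinfun.scaleR_right algebra_simps)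
  fix v w
  show "root_refl \<alpha> v \<bullet> root_refl \<alpha> w = v \<bullet> w"
  \<comment> \<open>For the zero functional \<open>coroot\<close> is zero too, so the map is the
    identity.\<close>
  proof (cases "riesz \<alpha> = 0")
    case False
    then show ?thesis
      by (simp add: root_refl_def blinfun_apply_riesz coroot_def inner_diff_left inner_diff_right
          inner_commute field_simps)
  qed (simp add: root_refl_def coroot_def)
qed

lemma (in ring) add_diff_cancel_left:
  assumes "a \<in> carrier R" "b \<in> carrier R"
  shows "a \<oplus> (b \<ominus> a) = b"
  using assms unfolding a_minus_def by (metis a_comm a_inv_closed r_neg1 add.m_lcomm)

text \<open>These properties make \<open>smash_monoid W\<close> a monoid: orthogonal maps are linear
  bijections, so \<open>inv_into UNIV\<close> is a true inverse and \<open>hh_act\<close> respects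
  composition.\<close>

locale orthogonal_monoid =
  fixes W :: "('e::euclidean_space \<Rightarrow> 'e) set"
  assumes id_W: "id \<in> W"
    and comp_W: "v \<in> W \<Longrightarrow> w \<in> W \<Longrightarrow> v \<circ> w \<in> W"
    and orthogonal_W: "w \<in> W \<Longrightarrow> orthogonal_transformation w"
begin

text \<open>\<open>Blinfun\<close> can be evaluated only at bounded linear maps; the inverse of an
  orthogonal transformation is linear, hence bounded in finite dimension.\<close>

lemma dual_act_apply: "w \<in> W \<Longrightarrow> blinfun_apply (dual_act w \<alpha>) v = blinfun_apply \<alpha> (inv_into UNIV w v)"
proof -
  assume "w \<in> W"
  then have "linear (inv_into UNIV w)"
    by (intro orthogonal_transformation_linear orthogonal_transformation_inv orthogonal_W)
  then have "bounded_linear (\<lambda>v. blinfun_apply \<alpha> (inv_into UNIV w v))"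
    by (intro bounded_linear_compose[OF blinfun.bounded_linear_right]) (simp add: linear_conv_bounded_linear)
  then show ?thesis
    unfolding dual_act_def by (simp add: bounded_linear_Blinfun_apply)
qed

lemma bij_W: "w \<in> W \<Longrightarrow> bij w"
  by (simp add: orthogonal_W orthogonal_transformation_bij)

lemma dual_act_comp: "v \<in> W \<Longrightarrow> w \<in> W \<Longrightarrow> dual_act (v \<circ> w) \<alpha> = dual_act v (dual_act w \<alpha>)"
  by (rule blinfun_eqI) (simp add: dual_act_apply comp_W o_inv_distrib bij_W)

lemma dual_act_id: "dual_act id \<alpha> = \<alpha>" for \<alpha> :: "'e dual"
  by (rule blinfun_eqI) (simp only: dual_act_apply[OF id_W] inv_id id_apply)

lemma hh_act_comp: "v \<in> W \<Longrightarrow> w \<in> W \<Longrightarrow> hh_act (v \<circ> w) u = hh_act v (hh_act w u)"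
  by (cases u) (auto simp: hh_act_def dual_act_comp)

lemma hh_act_id: "hh_act id u = u" for u :: "'e hh"
  by (cases u) (auto simp: hh_act_def dual_act_id)

lemma monoid_smash: "monoid (smash_monoid W)"
proof (rule monoidI)
  fix p q r assume "p \<in> carrier (smash_monoid W)" "q \<in> carrier (smash_monoid W)" "r \<in> carrier (smash_monoid W)"
  then show "p \<otimes>\<^bsub>smash_monoid W\<^esub> q \<otimes>\<^bsub>smash_monoid W\<^esub> r = p \<otimes>\<^bsub>smash_monoid W\<^esub> (q \<otimes>\<^bsub>smash_monoid W\<^esub> r)"
    by (auto simp: smash_monoid_def hh_act_comp o_assoc)
qed (auto simp: smash_monoid_def id_W comp_W hh_act_id map_idI)

lemma smash_word: "w \<in> W \<Longrightarrow> Poly_Mapping.single (us, w) z \<in> carrier (monoid_alg (smash_monoid W))"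
  by (rule single_in_monoid_alg) (simp add: smash_monoid_def)

lemma quotient_smash: "algebra_quotient (monoid_alg (smash_monoid W)) multilin_rels"
proof (intro algebra_quotient.intro algebra_quotient_axioms.intro complex_algebra_monoid_alg monoid_smash)
  show "multilin_rels \<subseteq> carrier (monoid_alg (smash_monoid W))"
    unfolding multilin_rels_def
    using diff_in_monoid_alg[OF monoid_smash] smash_word[OF id_W] by blast
qed

lemma complex_algebra_smash: "complex_algebra (smash W)"
  unfolding smash_def by (rule algebra_quotient.complex_algebra_Q[OF quotient_smash])

lemma smash_vec_closed: "smash_vec W u \<in> carrier (smash W)"
  unfolding smash_def smash_vec_def
  by (rule algebra_quotient.proj_closed[OF quotient_smash smash_word[OF id_W]])

lemma smash_grp_closed: "w \<in> W \<Longrightarrow> smash_grp W w \<in> carrier (smash W)"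
  unfolding smash_def smash_grp_def
  by (rule algebra_quotient.proj_closed[OF quotient_smash smash_word])

lemma smash_vec_linear:
  "smash_vec W (hh_scale z u + v) = z \<odot>\<^bsub>smash W\<^esub> smash_vec W u \<oplus>\<^bsub>smash W\<^esub> smash_vec W v"
proof -
  interpret Q: algebra_quotient "monoid_alg (smash_monoid W)" multilin_rels by (rule quotient_smash)
  note [simp del] = monoid_alg_simps(1)
  note s = smash_word[OF id_W]
  have "smash_vec W (hh_scale z u + v)
    = Q.\<pi> (Poly_Mapping.single ([u], id) z + Poly_Mapping.single ([v], id) 1)"
    unfolding smash_vec_def
  proof (rule Q.proj_eqI[OF s add_in_monoid_alg[OF monoid_smash s s]])
    show "Poly_Mapping.single ([hh_scale z u + v], id) 1 \<ominus>\<^bsub>monoid_alg (smash_monoid W)\<^esub>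
        (Poly_Mapping.single ([u], id) z + Poly_Mapping.single ([v], id) 1) \<in> multilin_rels"
      unfolding monoid_alg_minus[OF monoid_smash s add_in_monoid_alg[OF monoid_smash s s]]
      unfolding multilin_rels_def diff_diff_eq[symmetric] by blast
  qed
  also have "\<dots> = Q.\<pi> (Poly_Mapping.single ([u], id) z) \<oplus>\<^bsub>smash W\<^esub> smash_vec W v"
    using Q.proj_add[OF s s, of "[u]" z "[v]" 1] by (simp add: smash_def smash_vec_def)
  also have "Q.\<pi> (Poly_Mapping.single ([u], id) z) = z \<odot>\<^bsub>smash W\<^esub> smash_vec W u"
    using Q.proj_smult[OF s, of z "[u]" 1] by (simp add: smash_def smash_vec_def)
  finally show ?thesis .
qed

text \<open>The equality holds before any quotient is taken: both products are the word
  \<open>([hh_act w u], w)\<close>.\<close>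

lemma smash_grp_vec:
  assumes w: "w \<in> W"
  shows "smash_grp W w \<otimes>\<^bsub>smash W\<^esub> smash_vec W u = smash_vec W (hh_act w u) \<otimes>\<^bsub>smash W\<^esub> smash_grp W w"
proof -
  interpret Q: algebra_quotient "monoid_alg (smash_monoid W)" multilin_rels by (rule quotient_smash)
  note [simp del] = monoid_alg_simps(1)
  have m: "([], w) \<otimes>\<^bsub>smash_monoid W\<^esub> ([u], id) = ([hh_act w u], id) \<otimes>\<^bsub>smash_monoid W\<^esub> ([], w)"
    by (simp add: smash_monoid_def)
  show ?thesis
    using Q.proj_mult[OF smash_word[OF w] smash_word[OF id_W], of "[]" 1 "[u]" 1]
      Q.proj_mult[OF smash_word[OF id_W] smash_word[OF w], of "[hh_act w u]" 1 "[]" 1]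
    by (simp add: smash_def smash_grp_def smash_vec_def m)
qed

end

section \<open>The rational Cherednik algebra\<close>

locale cherednik_algebra = orthogonal_monoid W for W :: "('e::euclidean_space \<Rightarrow> 'e) set" +
  fixes P :: "'e dual set" and c :: "'e dual \<Rightarrow> complex"
  assumes finite_P: "finite P"
    and refl_W: "\<alpha> \<in> P \<Longrightarrow> root_refl \<alpha> \<in> W"
begin

abbreviation "H \<equiv> cherednik W P c"
abbreviation "HX \<equiv> ch_x W P c"
abbreviation "HY \<equiv> ch_y W P c"
abbreviation "HG \<equiv> ch_grp W P c"

definition yx_term :: "'e dual cplx \<Rightarrow> 'e cplx \<Rightarrow> ('e word \<Rightarrow>\<^sub>0 complex) set" where
  "yx_term \<xi> y = cplx_pairing \<xi> y \<odot>\<^bsub>smash W\<^esub> \<one>\<^bsub>smash W\<^esub> \<oplus>\<^bsub>smash W\<^esub>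
         (\<Oplus>\<^bsub>smash W\<^esub>\<alpha>\<in>P.
            (c \<alpha> * cplx_pairing (cplx_of \<alpha>) y * cplx_pairing \<xi> (cplx_of (coroot \<alpha>)))
              \<odot>\<^bsub>smash W\<^esub> smash_grp W (root_refl \<alpha>))"

lemma cherednik_rels_eq: "cherednik_rels W P c =
     {commutator (smash W) (smash_vec W (\<xi>, 0)) (smash_vec W (\<xi>', 0)) | \<xi> \<xi>'. True} \<union>
     {commutator (smash W) (smash_vec W (0, y)) (smash_vec W (0, y')) | y y'. True} \<union>
     {commutator (smash W) (smash_vec W (0, y)) (smash_vec W (\<xi>, 0)) \<ominus>\<^bsub>smash W\<^esub> yx_term \<xi> y | \<xi> y. True}"
  unfolding cherednik_rels_def yx_term_def by (rule refl)

sublocale smash: complex_algebra "smash W"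
  by (rule complex_algebra_smash)

lemma yx_term_closed: "yx_term \<xi> y \<in> carrier (smash W)"
  unfolding yx_term_def
  by (intro smash.add.m_closed smash.smult_closed smash.one_closed smash.finsum_closed)
    (auto intro: smash.smult_closed smash_grp_closed refl_W)

lemma commutator_closed: "a \<in> carrier (smash W) \<Longrightarrow> b \<in> carrier (smash W) \<Longrightarrow> commutator (smash W) a b \<in> carrier (smash W)"
  by (simp add: commutator_def)

sublocale Q: algebra_quotient "smash W" "cherednik_rels W P c"
  by unfold_locales
    (auto simp: cherednik_rels_eq intro!: commutator_closed smash_vec_closed smash.minus_closed yx_term_closed)

lemma complex_algebra_H: "complex_algebra H"
  unfolding cherednik_def by (rule Q.complex_algebra_Q)

sublocale H: complex_algebra H
  by (rule complex_algebra_H)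

lemma HX_closed: "HX \<xi> \<in> carrier H" and HY_closed: "HY v \<in> carrier H"
  and HG_closed: "w \<in> W \<Longrightarrow> HG w \<in> carrier H"
  unfolding cherednik_def ch_x_def ch_y_def ch_grp_def
  by (simp_all add: smash_vec_closed smash_grp_closed)

lemma proj_mult_H:
  assumes "a \<in> carrier (smash W)" "b \<in> carrier (smash W)"
  shows "Q.\<pi> a \<otimes>\<^bsub>H\<^esub> Q.\<pi> b = Q.\<pi> (a \<otimes>\<^bsub>smash W\<^esub> b)"
  unfolding cherednik_def by (rule Q.proj_mult[OF assms, symmetric])

lemma commute_H:
  assumes "a \<in> carrier (smash W)" "b \<in> carrier (smash W)" "commutator (smash W) a b \<in> cherednik_rels W P c"
  shows "Q.\<pi> a \<otimes>\<^bsub>H\<^esub> Q.\<pi> b = Q.\<pi> b \<otimes>\<^bsub>H\<^esub> Q.\<pi> a"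
proof -
  have "Q.\<pi> (a \<otimes>\<^bsub>smash W\<^esub> b) = Q.\<pi> (b \<otimes>\<^bsub>smash W\<^esub> a)"
    by (rule Q.proj_eqI) (use assms in \<open>auto simp: commutator_def\<close>)
  then show ?thesis using assms by (simp add: proj_mult_H)
qed

lemma HX_commute: "HX \<xi> \<otimes>\<^bsub>H\<^esub> HX \<xi>' = HX \<xi>' \<otimes>\<^bsub>H\<^esub> HX \<xi>"
  unfolding ch_x_def by (intro commute_H smash_vec_closed, unfold cherednik_rels_eq) blast

lemma HY_commute: "HY v \<otimes>\<^bsub>H\<^esub> HY v' = HY v' \<otimes>\<^bsub>H\<^esub> HY v"
  unfolding ch_y_def by (intro commute_H smash_vec_closed, unfold cherednik_rels_eq) blast

lemma proj_finsum:
  "F \<in> S \<rightarrow> carrier (smash W) \<Longrightarrow> Q.\<pi> (finsum (smash W) F S) = finsum H (\<lambda>s. Q.\<pi> (F s)) S"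
proof (induction S rule: infinite_finite_induct)
  case (insert s S)
  then have F: "F s \<in> carrier (smash W)" "F \<in> S \<rightarrow> carrier (smash W)" by auto
  have "Q.\<pi> (finsum (smash W) F (insert s S)) = Q.\<pi> (F s) \<oplus>\<^bsub>H\<^esub> Q.\<pi> (finsum (smash W) F S)"
    using insert F by (simp add: Q.proj_add cherednik_def)
  also have "\<dots> = finsum H (\<lambda>s. Q.\<pi> (F s)) (insert s S)"
    using insert F by (subst H.finsum_insert) (auto simp: cherednik_def intro!: Q.proj_closed)
  finally show ?case .
next
  case empty
  have "Q.\<pi> \<zero>\<^bsub>smash W\<^esub> = \<zero>\<^bsub>H\<^esub>"
    unfolding cherednik_def by (rule ring_hom_zero[OF Q.proj_hom smash.ring_axioms Q.ring_Q])
  then show ?case by simp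
next
  case (infinite S)
  have "Q.\<pi> \<zero>\<^bsub>smash W\<^esub> = \<zero>\<^bsub>H\<^esub>"
    unfolding cherednik_def by (rule ring_hom_zero[OF Q.proj_hom smash.ring_axioms Q.ring_Q])
  with infinite show ?case by (simp add: smash.finsum_infinite H.finsum_infinite)
qed

lemma HY_HX:
  "HY v \<otimes>\<^bsub>H\<^esub> HX \<xi> = HX \<xi> \<otimes>\<^bsub>H\<^esub> HY v \<oplus>\<^bsub>H\<^esub> (cplx_pairing \<xi> v \<odot>\<^bsub>H\<^esub> \<one>\<^bsub>H\<^esub> \<oplus>\<^bsub>H\<^esub>
     (\<Oplus>\<^bsub>H\<^esub>\<alpha>\<in>P. (c \<alpha> * cplx_pairing (cplx_of \<alpha>) v * cplx_pairing \<xi> (cplx_of (coroot \<alpha>)))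
        \<odot>\<^bsub>H\<^esub> HG (root_refl \<alpha>)))"
proof -
  let ?a = "smash_vec W (0, v)" and ?b = "smash_vec W (\<xi>, 0)"
  have cl: "?a \<in> carrier (smash W)" "?b \<in> carrier (smash W)" by (rule smash_vec_closed)+
  have "Q.\<pi> (commutator (smash W) ?a ?b) = Q.\<pi> (yx_term \<xi> v)"
    by (intro Q.proj_eqI commutator_closed cl yx_term_closed, unfold cherednik_rels_eq) blast
  also have "Q.\<pi> (yx_term \<xi> v) = cplx_pairing \<xi> v \<odot>\<^bsub>H\<^esub> \<one>\<^bsub>H\<^esub> \<oplus>\<^bsub>H\<^esub>
     (\<Oplus>\<^bsub>H\<^esub>\<alpha>\<in>P. (c \<alpha> * cplx_pairing (cplx_of \<alpha>) v * cplx_pairing \<xi> (cplx_of (coroot \<alpha>)))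
        \<odot>\<^bsub>H\<^esub> HG (root_refl \<alpha>))" (is "_ = ?t")
  proof -
    let ?F = "\<lambda>\<alpha>. (c \<alpha> * cplx_pairing (cplx_of \<alpha>) v * cplx_pairing \<xi> (cplx_of (coroot \<alpha>)))
        \<odot>\<^bsub>smash W\<^esub> smash_grp W (root_refl \<alpha>)"
    have F: "?F \<in> P \<rightarrow> carrier (smash W)"
      by (auto intro: smash_grp_closed refl_W)
    have "Q.\<pi> (finsum (smash W) ?F P) = (\<Oplus>\<^bsub>H\<^esub>\<alpha>\<in>P. (c \<alpha> * cplx_pairing (cplx_of \<alpha>) v * cplx_pairing \<xi> (cplx_of (coroot \<alpha>)))
        \<odot>\<^bsub>H\<^esub> HG (root_refl \<alpha>))"
      unfolding proj_finsum[OF F]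
      by (rule H.finsum_cong') (auto simp: ch_grp_def Q.proj_smult[folded cherednik_def] smash_grp_closed refl_W
          intro!: H.smult_closed Q.proj_closed[folded cherednik_def])
    then show ?thesis
      unfolding yx_term_def
      by (simp add: Q.proj_add Q.proj_smult Q.proj_one F smash.finsum_closed cherednik_def[symmetric])
  qed
  finally have "HY v \<otimes>\<^bsub>H\<^esub> HX \<xi> \<ominus>\<^bsub>H\<^esub> HX \<xi> \<otimes>\<^bsub>H\<^esub> HY v = ?t"
    using cl by (simp add: commutator_def Q.proj_minus Q.proj_mult ch_x_def ch_y_def cherednik_def)
  then have "HX \<xi> \<otimes>\<^bsub>H\<^esub> HY v \<oplus>\<^bsub>H\<^esub> ?t = HX \<xi> \<otimes>\<^bsub>H\<^esub> HY v \<oplus>\<^bsub>H\<^esub> (HY v \<otimes>\<^bsub>H\<^esub> HX \<xi> \<ominus>\<^bsub>H\<^esub> HX \<xi> \<otimes>\<^bsub>H\<^esub> HY v)"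
    by simp
  also have "\<dots> = HY v \<otimes>\<^bsub>H\<^esub> HX \<xi>"
    using H.m_closed[OF HX_closed HY_closed, of \<xi> v] H.m_closed[OF HY_closed HX_closed, of v \<xi>]
    by (rule H.add_diff_cancel_left)
  finally show ?thesis by simp
qed

text \<open>Additivity and homogeneity are kept in one identity, following
  \<open>multilin_rels\<close>. The scalar is real because \<open>cplx_of\<close> is compatible with
  real scaling.\<close>

lemma HX_linear: "HX (cplx_of (r *\<^sub>R \<xi> + \<eta>)) = of_real r \<odot>\<^bsub>H\<^esub> HX (cplx_of \<xi>) \<oplus>\<^bsub>H\<^esub> HX (cplx_of \<eta>)"
proof -
  have "(cplx_of (r *\<^sub>R \<xi> + \<eta>), 0) = hh_scale (of_real r) (cplx_of \<xi>, 0) + ((cplx_of \<eta>, 0) :: 'e hh)"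
    by (simp add: cplx_of_def hh_scale_def cplx_scale_def zero_prod_def)
  then show ?thesis
    by (simp add: ch_x_def smash_vec_linear Q.proj_add Q.proj_smult smash_vec_closed cherednik_def)
qed

lemma HY_linear: "HY (cplx_of (r *\<^sub>R v + w)) = of_real r \<odot>\<^bsub>H\<^esub> HY (cplx_of v) \<oplus>\<^bsub>H\<^esub> HY (cplx_of w)"
proof -
  have "(0, cplx_of (r *\<^sub>R v + w)) = hh_scale (of_real r) (0, cplx_of v) + ((0, cplx_of w) :: 'e hh)"
    by (simp add: cplx_of_def hh_scale_def cplx_scale_def zero_prod_def)
  then show ?thesis
    by (simp add: ch_y_def smash_vec_linear Q.proj_add Q.proj_smult smash_vec_closed cherednik_def)
qed

lemma dual_act_zero: "w \<in> W \<Longrightarrow> dual_act w 0 = 0"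
  by (rule blinfun_eqI) (simp add: dual_act_apply)

lemma HG_HX:
  assumes w: "w \<in> W"
  shows "HG w \<otimes>\<^bsub>H\<^esub> HX (cplx_of \<xi>) = HX (cplx_of (dual_act w \<xi>)) \<otimes>\<^bsub>H\<^esub> HG w"
proof -
  have "hh_act w (cplx_of \<xi>, 0) = (cplx_of (dual_act w \<xi>), 0)"
    using w orthogonal_transformation_linear[OF orthogonal_W[OF w]]
    by (simp add: hh_act_def cplx_of_def dual_act_zero zero_prod_def linear_0)
  then show ?thesis
    using smash_grp_vec[OF w, of "(cplx_of \<xi>, 0)"]
    by (simp add: ch_grp_def ch_x_def proj_mult_H smash_grp_closed w smash_vec_closed)
qed

lemma HG_HY:
  assumes w: "w \<in> W"
  shows "HG w \<otimes>\<^bsub>H\<^esub> HY (cplx_of v) = HY (cplx_of (w v)) \<otimes>\<^bsub>H\<^esub> HG w"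
proof -
  have "hh_act w (0, cplx_of v) = (0, cplx_of (w v))"
    using w orthogonal_transformation_linear[OF orthogonal_W[OF w]]
    by (simp add: hh_act_def cplx_of_def dual_act_zero zero_prod_def linear_0)
  then show ?thesis
    using smash_grp_vec[OF w, of "(0, cplx_of v)"]
    by (simp add: ch_grp_def ch_y_def proj_mult_H smash_grp_closed w smash_vec_closed)
qed

end

section \<open>The Dunkl angular momentum algebra\<close>

text \<open>As many orthonormal vectors as the dimension must span. The error of the expansion is
  orthogonal to all of them, hence to itself.\<close>

lemma orthonormal_expansion:
  fixes y :: "nat \<Rightarrow> 'e::euclidean_space"
  assumes orth: "\<And>i j. i \<in> {1..DIM('e)} \<Longrightarrow> j \<in> {1..DIM('e)} \<Longrightarrow> y i \<bullet> y j = (if i = j then 1 else 0)"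
  shows "v = (\<Sum>i\<in>{1..DIM('e)}. (y i \<bullet> v) *\<^sub>R y i)"
proof -
  let ?I = "{1..DIM('e)}"
  have inj: "inj_on y ?I"
    by (rule inj_onI) (metis orth zero_neq_one)
  have "independent (y ` ?I)"
  proof (rule pairwise_orthogonal_independent)
    show "pairwise orthogonal (y ` ?I)"
      by (auto simp: pairwise_def orthogonal_def orth)
    show "0 \<notin> y ` ?I"
      by (metis (no_types, lifting) imageE inner_zero_left orth zero_neq_one)
  qed
  then have span: "UNIV \<subseteq> span (y ` ?I)"
    by (intro card_ge_dim_independent) (simp_all add: card_image[OF inj] del: One_nat_def)
  define w where "w = v - (\<Sum>i\<in>?I. (y i \<bullet> v) *\<^sub>R y i)"
  have "orthogonal w u" if u: "u \<in> y ` ?I" for u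
  proof -
    obtain j where j: "j \<in> ?I" "u = y j" using u by auto
    have "(\<Sum>i\<in>?I. (y i \<bullet> v) * (y i \<bullet> y j)) = (\<Sum>i\<in>?I. if i = j then y i \<bullet> v else 0)"
      using j by (intro sum.cong) (auto simp: orth)
    then show ?thesis
      using j by (simp add: orthogonal_def w_def inner_diff_left inner_sum_left inner_commute[of v])
  qed
  then have "orthogonal w w"
    using span by (intro orthogonal_to_span[of w "y ` ?I" w]) auto
  then show ?thesis by (simp add: orthogonal_self w_def)
qed

text \<open>This links the sums over i < j in the definitions of the Dirac element and of M^2 with
  the sums over all pairs used in \<open>ama_clifford_relations\<close>.\<close>

lemma sum_index_pairs:
  fixes F :: "nat \<Rightarrow> nat \<Rightarrow> 'v::real_vector"
  assumes sym: "\<And>i j. i \<in> {1..n} \<Longrightarrow> j \<in> {1..n} \<Longrightarrow> i \<noteq> j \<Longrightarrow> F j i = F i j"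
    and diag: "\<And>i. i \<in> {1..n} \<Longrightarrow> F i i = 0"
  shows "(\<Sum>i\<in>{1..n}. \<Sum>j\<in>{1..n}. F i j) = 2 *\<^sub>R (\<Sum>(i, j)\<in>index_pairs n. F i j)"
proof -
  let ?A = "index_pairs n"
  have fin: "finite ?A"
    by (rule finite_subset[of _ "{1..n} \<times> {1..n}"]) (auto simp: index_pairs_def)
  have "(\<Sum>i\<in>{1..n}. \<Sum>j\<in>{1..n}. F i j) = (\<Sum>(i, j)\<in>{1..n} \<times> {1..n}. F i j)"
    by (rule sum.cartesian_product)
  also have "\<dots> = (\<Sum>(i, j)\<in>?A \<union> prod.swap ` ?A. F i j)"
    by (rule sum.mono_neutral_right) (auto simp: index_pairs_def diag image_iff, force simp: diag not_less_iff_gr_or_eq)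
  also have "\<dots> = (\<Sum>(i, j)\<in>?A. F i j) + (\<Sum>(i, j)\<in>prod.swap ` ?A. F i j)"
    using fin by (intro sum.union_disjoint) (auto simp: index_pairs_def)
  also have "(\<Sum>(i, j)\<in>prod.swap ` ?A. F i j) = (\<Sum>(i, j)\<in>?A. F j i)"
    by (subst sum.reindex) (auto simp: inj_on_def case_prod_unfold)
  also have "\<dots> = (\<Sum>(i, j)\<in>?A. F i j)"
    by (intro sum.cong refl) (auto simp: index_pairs_def intro: sym)
  finally show ?thesis by (simp add: scaleR_2)
qed

lemma algebra_map_subalgebra:
  assumes "algebra_map A f" "S \<subseteq> carrier A"
  shows "algebra_map (subalgebra_generated A S) f"
proof -
  interpret algebra_map A f by fact
  interpret B: complex_algebra "subalgebra_generated A S"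
    by (rule complex_algebra_generated) (rule complex_algebra_axioms, fact)
  have "range (\<lambda>z. z \<odot>\<^bsub>A\<^esub> \<one>\<^bsub>A\<^esub>) \<union> S \<subseteq> carrier A" using assms(2) by auto
  then have "carrier (subalgebra_generated A S) \<subseteq> carrier A"
    unfolding subalgebra_generated_def using generate_ring_incl by simp
  then show ?thesis
    by unfold_locales (auto simp: subalgebra_generated_def map_add map_mult map_smult subset_iff)
qed

locale dunkl_angular_momentum = cherednik_algebra W P c
  for W :: "('e::euclidean_space \<Rightarrow> 'e) set" and P c +
  fixes x :: "nat \<Rightarrow> 'e dual" and y :: "nat \<Rightarrow> 'e"
  assumes nonzero: "\<alpha> \<in> P \<Longrightarrow> \<alpha> \<noteq> 0"
    and orth: "\<And>i j. i \<in> {1..DIM('e)} \<Longrightarrow> j \<in> {1..DIM('e)} \<Longrightarrow> y i \<bullet> y j = (if i = j then 1 else 0)"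
    and dual: "\<And>i j. i \<in> {1..DIM('e)} \<Longrightarrow> j \<in> {1..DIM('e)} \<Longrightarrow>
           blinfun_apply (x i) (y j) = (if i = j then 1 else 0)"
begin

section \<open>Coordinates of roots and coroots\<close>

abbreviation a :: "'e dual \<Rightarrow> nat \<Rightarrow> real" where "a \<alpha> i \<equiv> blinfun_apply \<alpha> (y i)"
abbreviation b :: "'e dual \<Rightarrow> nat \<Rightarrow> real" where "b \<alpha> i \<equiv> blinfun_apply (x i) (coroot \<alpha>)"

lemma x_inner: "i \<in> {1..DIM('e)} \<Longrightarrow> blinfun_apply (x i) v = y i \<bullet> v"
proof -
  assume i: "i \<in> {1..DIM('e)}"
  have "blinfun_apply (x i) v = blinfun_apply (x i) (\<Sum>j\<in>{1..DIM('e)}. (y j \<bullet> v) *\<^sub>R y j)"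
    by (intro arg_cong[OF orthonormal_expansion] orth)
  also have "\<dots> = (\<Sum>j\<in>{1..DIM('e)}. if j = i then y j \<bullet> v else 0)"
    unfolding blinfun.sum_right blinfun.scaleR_right using i by (intro sum.cong) (auto simp: dual)
  finally show ?thesis using i by simp
qed

lemma root_expansion: "\<alpha> = (\<Sum>m\<in>{1..DIM('e)}. a \<alpha> m *\<^sub>R x m)"
proof (rule blinfun_eqI)
  fix v
  have "blinfun_apply \<alpha> v = blinfun_apply \<alpha> (\<Sum>j\<in>{1..DIM('e)}. (y j \<bullet> v) *\<^sub>R y j)"
    by (intro arg_cong[OF orthonormal_expansion] orth)
  also have "\<dots> = blinfun_apply (\<Sum>m\<in>{1..DIM('e)}. a \<alpha> m *\<^sub>R x m) v"
    unfolding blinfun.sum_right blinfun.scaleR_right blinfun.sum_left blinfun.scaleR_left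
    by (intro sum.cong) (auto simp: x_inner)
  finally show "blinfun_apply \<alpha> v = blinfun_apply (\<Sum>m\<in>{1..DIM('e)}. a \<alpha> m *\<^sub>R x m) v" .
qed

lemma coroot_expansion: "coroot \<alpha> = (\<Sum>m\<in>{1..DIM('e)}. b \<alpha> m *\<^sub>R y m)"
proof -
  have "coroot \<alpha> = (\<Sum>m\<in>{1..DIM('e)}. (y m \<bullet> coroot \<alpha>) *\<^sub>R y m)"
    by (intro orthonormal_expansion orth)
  also have "\<dots> = (\<Sum>m\<in>{1..DIM('e)}. b \<alpha> m *\<^sub>R y m)"
    by (intro sum.cong) (auto simp: x_inner)
  finally show ?thesis .
qed

text \<open>In an orthonormal basis root and coroot have proportional coordinates. The symmetry
  \<open>ab\<close>, and with it that of the commutators of the y with the x, comes from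
  here.\<close>

lemma b_eq: "i \<in> {1..DIM('e)} \<Longrightarrow> b \<alpha> i = 2 / (riesz \<alpha> \<bullet> riesz \<alpha>) * a \<alpha> i"
  by (simp add: x_inner coroot_def blinfun_apply_riesz[of \<alpha>] inner_commute)

lemma ab: "i \<in> {1..DIM('e)} \<Longrightarrow> j \<in> {1..DIM('e)} \<Longrightarrow> a \<alpha> i * b \<alpha> j = a \<alpha> j * b \<alpha> i"
  by (simp add: b_eq)

lemma root_coroot:
  assumes "\<alpha> \<noteq> 0"
  shows "blinfun_apply \<alpha> (coroot \<alpha>) = 2"
proof -
  have "riesz \<alpha> \<noteq> 0"
  proof
    assume "riesz \<alpha> = 0"
    then have "\<alpha> = 0" by (intro blinfun_eqI) (simp add: blinfun_apply_riesz[of \<alpha>])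
    with assms show False by simp
  qed
  then show ?thesis by (simp add: blinfun_apply_riesz[of \<alpha>] coroot_def)
qed

lemma ab_sum:
  assumes "\<alpha> \<in> P"
  shows "(\<Sum>m\<in>{1..DIM('e)}. a \<alpha> m * b \<alpha> m) = 2"
proof -
  have "blinfun_apply \<alpha> (coroot \<alpha>) = (\<Sum>m\<in>{1..DIM('e)}. b \<alpha> m * a \<alpha> m)"
    by (subst coroot_expansion) (simp add: blinfun.sum_right blinfun.scaleR_right)
  then show ?thesis using root_coroot[OF nonzero[OF assms]] by (simp add: mult.commute)
qed

text \<open>The inverse inside \<open>dual_act\<close> is harmless because a reflection in a nonzero
  root is an involution.\<close>

lemma dual_act_refl:
  assumes "\<alpha> \<in> P"
  shows "dual_act (root_refl \<alpha>) \<xi> = \<xi> - blinfun_apply \<xi> (coroot \<alpha>) *\<^sub>R \<alpha>"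
proof -
  have "root_refl \<alpha> (root_refl \<alpha> v) = v" for v
    by (simp add: root_refl_def blinfun.diff_right blinfun.scaleR_right root_coroot nonzero[OF assms])
  then have "inv_into UNIV (root_refl \<alpha>) = root_refl \<alpha>"
    by (intro inv_unique_comp) (auto simp: fun_eq_iff)
  then show ?thesis
    by (intro blinfun_eqI) (simp add: dual_act_apply[OF refl_W[OF assms]] root_refl_def
        blinfun.diff_right blinfun.scaleR_right blinfun.diff_left blinfun.scaleR_left)
qed

lemma pairing_real: "cplx_pairing (cplx_of \<xi>) (cplx_of v) = of_real (blinfun_apply \<xi> v)"
  by (simp add: cplx_pairing_def cplx_of_def complex_eq_iff)

section \<open>The Dunkl relations in the Cherednik algebra\<close>

abbreviation f :: "'e cherednik_elem \<Rightarrow> 'e cherednik_elem algebra_product" where "f \<equiv> algebra_embed H"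

sublocale f: algebra_map H f
  by (rule algebra_map_embed[OF complex_algebra_H])

definition gs :: "'e dual \<Rightarrow> 'e cherednik_elem" where
  "gs \<alpha> = c \<alpha> \<odot>\<^bsub>H\<^esub> HG (root_refl \<alpha>)"

lemma gs_closed: "\<alpha> \<in> P \<Longrightarrow> gs \<alpha> \<in> carrier H"
  by (simp add: gs_def HG_closed refl_W)

lemma linear_X: "linear (\<lambda>\<xi>. f (HX (cplx_of \<xi>)))"
proof -
  have s: "f (HX (cplx_of (r *\<^sub>R \<xi> + \<eta>))) = r *\<^sub>R f (HX (cplx_of \<xi>)) + f (HX (cplx_of \<eta>))" for r \<xi> \<eta>
    by (simp add: HX_linear f.map_add f.map_smult HX_closed)
  \<comment> \<open>With both vectors zero and r = 1, the value at 0 equals its own double.\<close>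
  have 0: "f (HX (cplx_of 0)) = 0" using s[of 1 0 0] by simp
  show ?thesis
    by (rule linearI) (use s[of 1] s[of _ _ 0] 0 in simp_all)
qed

lemma linear_Y: "linear (\<lambda>v. f (HY (cplx_of v)))"
proof -
  have s: "f (HY (cplx_of (r *\<^sub>R \<xi> + \<eta>))) = r *\<^sub>R f (HY (cplx_of \<xi>)) + f (HY (cplx_of \<eta>))" for r \<xi> \<eta>
    by (simp add: HY_linear f.map_add f.map_smult HY_closed)
  have 0: "f (HY (cplx_of 0)) = 0" using s[of 1 0 0] by simp
  show ?thesis
    by (rule linearI) (use s[of 1] s[of _ _ 0] 0 in simp_all)
qed

sublocale D: dunkl_relations "{1..DIM('e)}" P "\<lambda>i. f (HX (cplx_of (x i)))" "\<lambda>i. f (HY (cplx_of (y i)))"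
  "\<lambda>\<alpha>. f (gs \<alpha>)" "f \<one>\<^bsub>H\<^esub>" a b
proof
  fix i j assume ij: "i \<in> {1..DIM('e)}" "j \<in> {1..DIM('e)}"
  show "f (HX (cplx_of (x i))) * f (HX (cplx_of (x j))) = f (HX (cplx_of (x j))) * f (HX (cplx_of (x i)))"
    by (simp add: f.map_mult[symmetric] HX_closed HX_commute)
  show "f (HY (cplx_of (y i))) * f (HY (cplx_of (y j))) = f (HY (cplx_of (y j))) * f (HY (cplx_of (y i)))"
    by (simp add: f.map_mult[symmetric] HY_closed HY_commute)
  \<comment> \<open>The complex factor \<open>c \<alpha>\<close> moves into
    \<open>gs \<alpha>\<close>; the real coefficient that remains is one that \<open>f\<close>
    respects.\<close>
  have t: "(c \<alpha> * cplx_pairing (cplx_of \<alpha>) (cplx_of (y i)) * cplx_pairing (cplx_of (x j)) (cplx_of (coroot \<alpha>)))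
      \<odot>\<^bsub>H\<^esub> HG (root_refl \<alpha>) = of_real (a \<alpha> i * b \<alpha> j) \<odot>\<^bsub>H\<^esub> gs \<alpha>" if "\<alpha> \<in> P" for \<alpha>
    using that by (simp add: gs_def pairing_real H.smult_smult HG_closed refl_W mult_ac)
  let ?F = "\<lambda>\<alpha>. of_real (a \<alpha> i * b \<alpha> j) \<odot>\<^bsub>H\<^esub> gs \<alpha>"
  have F: "?F \<in> P \<rightarrow> carrier H" by (auto intro: gs_closed H.smult_closed)
  have "HY (cplx_of (y i)) \<otimes>\<^bsub>H\<^esub> HX (cplx_of (x j)) = HX (cplx_of (x j)) \<otimes>\<^bsub>H\<^esub> HY (cplx_of (y i))
      \<oplus>\<^bsub>H\<^esub> (of_real (if i = j then 1 else 0) \<odot>\<^bsub>H\<^esub> \<one>\<^bsub>H\<^esub> \<oplus>\<^bsub>H\<^esub> finsum H ?F P)"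
    unfolding HY_HX using ij F
    by (subst H.finsum_cong'[OF refl F t]) (simp_all add: pairing_real dual)
  then have "f (HY (cplx_of (y i)) \<otimes>\<^bsub>H\<^esub> HX (cplx_of (x j))) = f (HX (cplx_of (x j)) \<otimes>\<^bsub>H\<^esub> HY (cplx_of (y i)))
      + (f (of_real (if i = j then 1 else 0) \<odot>\<^bsub>H\<^esub> \<one>\<^bsub>H\<^esub>) + (\<Sum>\<alpha>\<in>P. f (?F \<alpha>)))"
    using F by (simp add: f.map_add f.map_finsum[OF F] HX_closed HY_closed del: of_real_mult)
  then show "f (HY (cplx_of (y i))) * f (HX (cplx_of (x j))) = f (HX (cplx_of (x j))) * f (HY (cplx_of (y i)))
      + ((if i = j then f \<one>\<^bsub>H\<^esub> else 0) + (\<Sum>\<alpha>\<in>P. (a \<alpha> i * b \<alpha> j) *\<^sub>R f (gs \<alpha>)))"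
    by (simp only: f.map_mult[OF HX_closed HY_closed] f.map_mult[OF HY_closed HX_closed] f.map_smult[OF H.one_closed])
      (auto simp: f.map_smult[OF gs_closed] simp flip: of_real_mult cong: sum.cong)
next
  fix \<alpha> i assume \<alpha>: "\<alpha> \<in> P" and i: "i \<in> {1..DIM('e)}"
  have gX: "gs \<alpha> \<otimes>\<^bsub>H\<^esub> HX (cplx_of \<xi>) = HX (cplx_of (dual_act (root_refl \<alpha>) \<xi>)) \<otimes>\<^bsub>H\<^esub> gs \<alpha>" for \<xi>
    using \<alpha> by (simp add: gs_def H.mult_smult_left H.mult_smult_right HG_closed HX_closed refl_W HG_HX)
  have gY: "gs \<alpha> \<otimes>\<^bsub>H\<^esub> HY (cplx_of v) = HY (cplx_of (root_refl \<alpha> v)) \<otimes>\<^bsub>H\<^esub> gs \<alpha>" for v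
    using \<alpha> by (simp add: gs_def H.mult_smult_left H.mult_smult_right HG_closed HY_closed refl_W HG_HY)
  have "f (HX (cplx_of \<alpha>)) = (\<Sum>m\<in>{1..DIM('e)}. a \<alpha> m *\<^sub>R f (HX (cplx_of (x m))))"
    by (subst root_expansion) (simp add: linear_sum[OF linear_X] linear_cmul[OF linear_X] o_def)
  then have "f (HX (cplx_of (dual_act (root_refl \<alpha>) (x i))))
    = f (HX (cplx_of (x i))) - b \<alpha> i *\<^sub>R (\<Sum>m\<in>{1..DIM('e)}. a \<alpha> m *\<^sub>R f (HX (cplx_of (x m))))"
    by (simp add: dual_act_refl[OF \<alpha>] linear_diff[OF linear_X] linear_cmul[OF linear_X])
  then show "f (gs \<alpha>) * f (HX (cplx_of (x i))) =
      (f (HX (cplx_of (x i))) - b \<alpha> i *\<^sub>R (\<Sum>m\<in>{1..DIM('e)}. a \<alpha> m *\<^sub>R f (HX (cplx_of (x m))))) * f (gs \<alpha>)"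
    using arg_cong[OF gX[of "x i"], of f] by (simp add: f.map_mult gs_closed \<alpha> HX_closed)
  have "f (HY (cplx_of (coroot \<alpha>))) = (\<Sum>m\<in>{1..DIM('e)}. b \<alpha> m *\<^sub>R f (HY (cplx_of (y m))))"
    by (subst coroot_expansion) (simp add: linear_sum[OF linear_Y] linear_cmul[OF linear_Y] o_def)
  then have "f (HY (cplx_of (root_refl \<alpha> (y i))))
    = f (HY (cplx_of (y i))) - a \<alpha> i *\<^sub>R (\<Sum>m\<in>{1..DIM('e)}. b \<alpha> m *\<^sub>R f (HY (cplx_of (y m))))"
    by (simp add: root_refl_def linear_diff[OF linear_Y] linear_cmul[OF linear_Y])
  then show "f (gs \<alpha>) * f (HY (cplx_of (y i))) =
      (f (HY (cplx_of (y i))) - a \<alpha> i *\<^sub>R (\<Sum>m\<in>{1..DIM('e)}. b \<alpha> m *\<^sub>R f (HY (cplx_of (y m))))) * f (gs \<alpha>)"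
    using arg_cong[OF gY[of "y i"], of f] by (simp add: f.map_mult gs_closed \<alpha> HY_closed)
next
  show "a \<alpha> i * b \<alpha> j = a \<alpha> j * b \<alpha> i" if "\<alpha> \<in> P" "i \<in> {1..DIM('e)}" "j \<in> {1..DIM('e)}" for \<alpha> i j
    using that(2,3) by (rule ab)
qed (simp_all add: f.map_mult[symmetric] HX_closed HY_closed)

section \<open>Relations inside the Dunkl angular momentum algebra\<close>

abbreviation "A \<equiv> ama W P c x y"
abbreviation "L \<equiv> ang_mom W P c x y"

lemma L_closed_H: "L i j \<in> carrier H"
  unfolding ang_mom_def by (intro H.minus_closed H.m_closed HX_closed HY_closed)

lemma f_L: "f (L i j) = D.M i j"
  by (simp add: ang_mom_def D.M_def f.map_diff f.map_mult HX_closed HY_closed)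

lemma generators_closed: "HG ` W \<union> (\<lambda>(i, j). L i j) ` index_pairs DIM('e) \<subseteq> carrier H"
  by (auto simp: HG_closed L_closed_H)

sublocale A: complex_algebra A
  unfolding ama_def by (rule complex_algebra_generated[OF complex_algebra_H generators_closed])

lemma f_A: "algebra_map A f"
  unfolding ama_def by (rule algebra_map_subalgebra[OF f.algebra_map_axioms generators_closed])

sublocale fA: algebra_map A f
  by (rule f_A)

lemma A_simps: "mult A = mult H" "add A = add H" "one A = one H" "zero A = zero H" "smult A = smult H"
  by (simp_all add: ama_def subalgebra_generated_def)

lemma generator_A: "g \<in> HG ` W \<union> (\<lambda>(i, j). L i j) ` index_pairs DIM('e) \<Longrightarrow> g \<in> carrier A"
  by (simp add: ama_def subalgebra_generated_def generate_ring.incl)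

lemma carrier_A_H: "g \<in> carrier A \<Longrightarrow> g \<in> carrier H"
  using H.generate_ring_in_carrier[of "range (\<lambda>z. z \<odot>\<^bsub>H\<^esub> \<one>\<^bsub>H\<^esub>) \<union> (HG ` W \<union> (\<lambda>(i, j). L i j) ` index_pairs DIM('e))"]
    generators_closed
  by (auto simp: ama_def subalgebra_generated_def)

text \<open>Equations between elements of \<open>A\<close> may therefore be checked in the image of
  \<open>H\<close>, where the x and y are at hand.\<close>

lemma f_inj: "g \<in> carrier A \<Longrightarrow> h \<in> carrier A \<Longrightarrow> f g = f h \<Longrightarrow> g = h"
  by (rule algebra_embed_inj[OF complex_algebra_H carrier_A_H carrier_A_H])

lemma gs_A: "\<alpha> \<in> P \<Longrightarrow> gs \<alpha> \<in> carrier A"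
  unfolding gs_def A_simps[symmetric]
  by (rule A.smult_closed, rule generator_A) (simp add: refl_W)

lemma L_antisym: "L i j = \<ominus>\<^bsub>H\<^esub> L j i"
  by (rule algebra_embed_inj[OF complex_algebra_H])
    (simp_all add: L_closed_H f.map_neg f_L D.M_def)

text \<open>Generators are given for i < j; antisymmetry, computed in \<open>H\<close>, yields the
  other pairs, which the cyclic relations involve as well.\<close>

lemma L_A:
  assumes "i \<in> {1..DIM('e)}" "j \<in> {1..DIM('e)}"
  shows "L i j \<in> carrier A"
proof -
  have less: "L i j \<in> carrier A" if "i < j" "i \<in> {1..DIM('e)}" "j \<in> {1..DIM('e)}" for i j
    using that by (intro generator_A) (auto simp: index_pairs_def)
  consider "i < j" | "j < i" | "i = j" by linarith
  then show ?thesis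
  proof cases
    case 2
    have "L i j = (-1) \<odot>\<^bsub>A\<^esub> L j i"
      unfolding A_simps by (subst L_antisym) (simp add: H.smult_minus_one L_closed_H)
    then show ?thesis using less[OF 2] assms by simp
  next
    case 3
    have "L i j = \<zero>\<^bsub>A\<^esub>"
      unfolding A_simps by (rule algebra_embed_inj[OF complex_algebra_H])
        (simp_all add: L_closed_H f.map_zero f_L D.M_def 3)
    then show ?thesis by simp
  qed (use assms less in auto)
qed

text \<open>The commutator of \<open>y i\<close> with \<open>x j\<close>, spelled out through group
  elements so that it is visibly in \<open>A\<close>.\<close>

definition SA :: "nat \<Rightarrow> nat \<Rightarrow> 'e cherednik_elem" where
  "SA i j = of_real (if i = j then 1 else 0) \<odot>\<^bsub>A\<^esub> \<one>\<^bsub>A\<^esub> \<oplus>\<^bsub>A\<^esub>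
     (\<Oplus>\<^bsub>A\<^esub>\<alpha>\<in>P. of_real (a \<alpha> i * b \<alpha> j) \<odot>\<^bsub>A\<^esub> gs \<alpha>)"

lemma SA_summand: "(\<lambda>\<alpha>. of_real (a \<alpha> i * b \<alpha> j) \<odot>\<^bsub>A\<^esub> gs \<alpha>) \<in> P \<rightarrow> carrier A"
  by (auto intro: gs_A A.smult_closed)

lemma SA_closed: "SA i j \<in> carrier A"
  unfolding SA_def by (intro A.add.m_closed A.finsum_closed SA_summand) simp

text \<open>Stated for an arbitrary map because it serves twice: for \<open>f\<close> on
  \<open>H\<close> and for \<open>g\<close> into the tensor product.\<close>

lemma map_SA:
  assumes "algebra_map A g"
  shows "g (SA i j) = (if i = j then g \<one>\<^bsub>A\<^esub> else 0) + (\<Sum>\<alpha>\<in>P. (a \<alpha> i * b \<alpha> j) *\<^sub>R g (gs \<alpha>))"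
proof -
  interpret g: algebra_map A g by fact
  show ?thesis
    unfolding SA_def
    by (subst g.map_add[OF A.smult_closed[OF A.one_closed] A.finsum_closed[OF SA_summand]],
        subst g.map_finsum[OF SA_summand], subst g.map_smult[OF A.one_closed])
      (auto simp: g.map_smult gs_A simp flip: of_real_mult intro!: sum.cong)
qed

lemma f_SA: "f (SA i j) = D.S i j"
  by (simp add: map_SA[OF f_A] D.S_def A_simps)

lemma crossing_A:
  assumes "i \<in> {1..DIM('e)}" "j \<in> {1..DIM('e)}" "k \<in> {1..DIM('e)}" "l \<in> {1..DIM('e)}"
  shows "L i j \<otimes>\<^bsub>A\<^esub> L k l \<oplus>\<^bsub>A\<^esub> L j k \<otimes>\<^bsub>A\<^esub> L i l \<oplus>\<^bsub>A\<^esub> L k i \<otimes>\<^bsub>A\<^esub> L j l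
    = L i j \<otimes>\<^bsub>A\<^esub> SA k l \<oplus>\<^bsub>A\<^esub> L j k \<otimes>\<^bsub>A\<^esub> SA i l \<oplus>\<^bsub>A\<^esub> L k i \<otimes>\<^bsub>A\<^esub> SA j l"
  using assms by (intro f_inj) (simp_all add: L_A SA_closed fA.map_add fA.map_mult f_L f_SA D.M_crossing)

text \<open>The correction from \<open>s_mult_M\<close> as an element of \<open>A\<close>, so that
  the conjugation rule becomes an equation in \<open>A\<close> to which \<open>g\<close> can be
  applied.\<close>

definition NA :: "'e dual \<Rightarrow> nat \<Rightarrow> nat \<Rightarrow> 'e cherednik_elem" where
  "NA \<alpha> i j = (\<Oplus>\<^bsub>A\<^esub>m\<in>{1..DIM('e)}. of_real (a \<alpha> m * b \<alpha> i) \<odot>\<^bsub>A\<^esub> L m j)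
     \<oplus>\<^bsub>A\<^esub> (\<Oplus>\<^bsub>A\<^esub>m\<in>{1..DIM('e)}. of_real (a \<alpha> j * b \<alpha> m) \<odot>\<^bsub>A\<^esub> L i m)"

lemma NA_summand:
  assumes "i \<in> {1..DIM('e)}" "j \<in> {1..DIM('e)}"
  shows "(\<lambda>m. of_real (a \<alpha> m * b \<alpha> i) \<odot>\<^bsub>A\<^esub> L m j) \<in> {1..DIM('e)} \<rightarrow> carrier A"
    "(\<lambda>m. of_real (a \<alpha> j * b \<alpha> m) \<odot>\<^bsub>A\<^esub> L i m) \<in> {1..DIM('e)} \<rightarrow> carrier A"
  using assms by (auto intro!: A.smult_closed L_A)

lemma NA_closed: "i \<in> {1..DIM('e)} \<Longrightarrow> j \<in> {1..DIM('e)} \<Longrightarrow> NA \<alpha> i j \<in> carrier A"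
  unfolding NA_def by (intro A.add.m_closed A.finsum_closed NA_summand)

lemma map_NA:
  assumes "algebra_map A g" and ij: "i \<in> {1..DIM('e)}" "j \<in> {1..DIM('e)}"
  shows "g (NA \<alpha> i j) = (\<Sum>m\<in>{1..DIM('e)}. (a \<alpha> m * b \<alpha> i) *\<^sub>R g (L m j)) + (\<Sum>m\<in>{1..DIM('e)}. (a \<alpha> j * b \<alpha> m) *\<^sub>R g (L i m))"
proof -
  interpret g: algebra_map A g by fact
  show ?thesis
    unfolding NA_def
    by (subst g.map_add[OF A.finsum_closed[OF NA_summand(1)[OF ij]] A.finsum_closed[OF NA_summand(2)[OF ij]]],
        subst g.map_finsum[OF NA_summand(1)[OF ij]], subst g.map_finsum[OF NA_summand(2)[OF ij]])
      (use ij in \<open>auto simp: g.map_smult L_A simp flip: of_real_mult intro!: sum.cong arg_cong2[of _ _ _ _ "(+)"]\<close>)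
qed

lemma gs_L:
  assumes "\<alpha> \<in> P" "i \<in> {1..DIM('e)}" "j \<in> {1..DIM('e)}"
  shows "gs \<alpha> \<otimes>\<^bsub>A\<^esub> L i j = (L i j \<ominus>\<^bsub>A\<^esub> NA \<alpha> i j) \<otimes>\<^bsub>A\<^esub> gs \<alpha>"
  using assms by (intro f_inj)
    (simp_all add: L_A gs_A NA_closed fA.map_mult fA.map_diff f_L D.s_mult_M map_NA[OF f_A] diff_diff_eq)

section \<open>Passage to the tensor product with the Clifford algebra\<close>

sublocale C: complex_algebra "clifford DIM('e)"
  by (rule complex_algebra_clifford)

sublocale T: algebra_tensor A "clifford DIM('e)"
  by unfold_locales

abbreviation "AC \<equiv> ama_cliff W P c x y"

lemma AC_eq: "AC = T.T"
  by (simp add: ama_cliff_def)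

definition g where "g u = algebra_embed AC (T.tensor u \<one>\<^bsub>clifford DIM('e)\<^esub>)"
definition h where "h u = algebra_embed AC (T.tensor \<one>\<^bsub>A\<^esub> u)"

abbreviation "\<gamma> i \<equiv> h (cliff_gen DIM('e) i)"

lemma g_map: "algebra_map A g"
  unfolding g_def[abs_def] AC_eq by (rule T.algebra_map_left)

sublocale g: algebra_map A g
  by (rule g_map)

sublocale h: algebra_map "clifford DIM('e)" h
  unfolding h_def[abs_def] AC_eq by (rule T.algebra_map_right)

sublocale E: algebra_map AC "algebra_embed AC"
  unfolding AC_eq by (rule algebra_map_embed[OF T.complex_algebra_T])

lemma gh: "u \<in> carrier A \<Longrightarrow> v \<in> carrier (clifford DIM('e)) \<Longrightarrow> g u * h v = algebra_embed AC (T.tensor u v)"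
  and hg: "u \<in> carrier A \<Longrightarrow> v \<in> carrier (clifford DIM('e)) \<Longrightarrow> h v * g u = algebra_embed AC (T.tensor u v)"
  unfolding g_def h_def AC_eq by (rule T.embed_tensor; assumption)+

text \<open>Both are the image of 1 \<otimes> 1, so one idempotent \<open>e\<close> serves both
  tensor factors.\<close>

lemma g_one: "g \<one>\<^bsub>A\<^esub> = h \<one>\<^bsub>clifford DIM('e)\<^esub>"
  by (simp add: g_def h_def)

sublocale R: ama_clifford_relations "{1..DIM('e)}" P "\<lambda>i j. g (L i j)" "\<lambda>\<alpha>. g (gs \<alpha>)" "g \<one>\<^bsub>A\<^esub>" a b \<gamma> "\<lambda>i j. g (SA i j)"
proof
  fix i j assume ij: "i \<in> {1..DIM('e)}" "j \<in> {1..DIM('e)}"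
  show "g (SA i j) = (if i = j then g \<one>\<^bsub>A\<^esub> else 0) + (\<Sum>\<alpha>\<in>P. (a \<alpha> i * b \<alpha> j) *\<^sub>R g (gs \<alpha>))"
    by (rule map_SA[OF g_map])
  have "L i j = (-1) \<odot>\<^bsub>A\<^esub> L j i"
    unfolding A_simps by (subst L_antisym) (simp add: H.smult_minus_one L_closed_H)
  then show "g (L i j) = - g (L j i)"
    using g.map_smult[OF L_A[OF ij(2,1)], of "-1"] by simp
  show "\<gamma> i * \<gamma> j + \<gamma> j * \<gamma> i = (if i = j then 2 *\<^sub>R g \<one>\<^bsub>A\<^esub> else 0)"
    using arg_cong[OF cliff_gen_anticommute[OF ij], of h] ij h.map_smult[OF C.one_closed, of 2]
      h.map_smult[OF C.one_closed, of 0]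
    by (simp add: h.map_add h.map_mult cliff_gen_closed g_one split: if_splits)
  show "g (L i j) * g \<one>\<^bsub>A\<^esub> = g (L i j)"
    using ij by (simp add: g.map_mult[symmetric] L_A)
next
  fix i j k l assume "i \<in> {1..DIM('e)}" "j \<in> {1..DIM('e)}" "k \<in> {1..DIM('e)}" "l \<in> {1..DIM('e)}"
  then show "g (L i j) * g (L k l) + g (L j k) * g (L i l) + g (L k i) * g (L j l)
     = g (L i j) * g (SA k l) + g (L j k) * g (SA i l) + g (L k i) * g (SA j l)"
    using arg_cong[OF crossing_A, of i j k l g] by (simp add: g.map_add g.map_mult L_A SA_closed)
next
  fix \<alpha> i j assume *: "\<alpha> \<in> P" "i \<in> {1..DIM('e)}" "j \<in> {1..DIM('e)}"
  then show "g (gs \<alpha>) * g (L i j) = (g (L i j) - (\<Sum>m\<in>{1..DIM('e)}. (a \<alpha> m * b \<alpha> i) *\<^sub>R g (L m j))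
      - (\<Sum>m\<in>{1..DIM('e)}. (a \<alpha> j * b \<alpha> m) *\<^sub>R g (L i m))) * g (gs \<alpha>)"
    using arg_cong[OF gs_L[OF *], of g]
    by (simp add: g.map_mult g.map_diff L_A gs_A NA_closed map_NA[OF g_map] diff_diff_eq)
next
  show "a \<alpha> i * b \<alpha> j = a \<alpha> j * b \<alpha> i" if "\<alpha> \<in> P" "i \<in> {1..DIM('e)}" "j \<in> {1..DIM('e)}" for \<alpha> i j
    using that(2,3) by (rule ab)
  show "(\<Sum>m\<in>{1..DIM('e)}. a \<alpha> m * b \<alpha> m) = 2" if "\<alpha> \<in> P" for \<alpha>
    using that by (rule ab_sum)
next
  fix k assume "k \<in> {1..DIM('e)}"
  then show "\<gamma> k * g \<one>\<^bsub>A\<^esub> = \<gamma> k" "g \<one>\<^bsub>A\<^esub> * \<gamma> k = \<gamma> k"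
    unfolding g_one by (simp_all add: h.map_mult[symmetric] cliff_gen_closed)
qed (simp_all add: gh hg L_A gs_A cliff_gen_closed g.map_mult[symmetric])

section \<open>Images of the Dirac element, M^2 and Z\<close>

lemma ind_mem: "(i, j) \<in> index_pairs DIM('e) \<Longrightarrow> i \<in> {1..DIM('e)} \<and> j \<in> {1..DIM('e)}"
  by (auto simp: index_pairs_def)

lemma dirac_summand: "(\<lambda>(i, j). T.tensor (L i j) (cliff_gen DIM('e) i \<otimes>\<^bsub>clifford DIM('e)\<^esub> cliff_gen DIM('e) j)) \<in> index_pairs DIM('e) \<rightarrow> carrier AC"
  unfolding AC_eq by (auto dest!: ind_mem intro!: T.tensor_closed L_A cliff_gen_closed)

lemma dirac_closed: "ama_dirac W P c x y \<in> carrier AC"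
  unfolding ama_dirac_def by (rule E.finsum_closed[OF dirac_summand])

text \<open>For distinct i and j both \<open>L i j\<close> and the product of the two Clifford
  generators change sign when i and j are exchanged, so the sum over i < j is half the full
  sum.\<close>

lemma embed_dirac: "algebra_embed AC (ama_dirac W P c x y) = R.D"
proof -
  have "algebra_embed AC (ama_dirac W P c x y) = (\<Sum>(i, j)\<in>index_pairs DIM('e). g (L i j) * (\<gamma> i * \<gamma> j))"
    unfolding ama_dirac_def E.map_finsum[OF dirac_summand]
    by (intro sum.cong) (auto dest!: ind_mem simp: h.map_mult[symmetric] cliff_gen_closed gh L_A)
  also have "2 *\<^sub>R \<dots> = R.bil (\<lambda>i j. g (L i j))"
    unfolding R.bil_def
  proof (rule sum_index_pairs[symmetric])
    show "g (L j i) * (\<gamma> j * \<gamma> i) = g (L i j) * (\<gamma> i * \<gamma> j)" if "i \<in> {1..DIM('e)}" "j \<in> {1..DIM('e)}" "i \<noteq> j" for i j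
      using that R.M_antisym[of j i] R.\<gamma>_swap[of j i] by simp
  qed (simp add: R.M_refl)
  finally have "R.bil (\<lambda>i j. g (L i j)) = 2 *\<^sub>R algebra_embed AC (ama_dirac W P c x y)"
    by simp
  then show ?thesis unfolding R.D_def by simp
qed

lemma M2_summand: "(\<lambda>(i, j). L i j \<otimes>\<^bsub>A\<^esub> L i j) \<in> index_pairs DIM('e) \<rightarrow> carrier A"
  by (auto dest!: ind_mem simp: L_A)

lemma M2_closed: "ama_M2 W P c x y \<in> carrier A"
  unfolding ama_M2_def by (rule A.finsum_closed[OF M2_summand])

lemma g_M2: "g (ama_M2 W P c x y) = (1/2) *\<^sub>R (\<Sum>i\<in>{1..DIM('e)}. \<Sum>j\<in>{1..DIM('e)}. g (L i j) * g (L i j))"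
proof -
  have "g (ama_M2 W P c x y) = (\<Sum>(i, j)\<in>index_pairs DIM('e). g (L i j) * g (L i j))"
    unfolding ama_M2_def g.map_finsum[OF M2_summand]
    by (intro sum.cong) (auto dest!: ind_mem simp: g.map_mult L_A)
  moreover have "(\<Sum>i\<in>{1..DIM('e)}. \<Sum>j\<in>{1..DIM('e)}. g (L i j) * g (L i j)) = 2 *\<^sub>R (\<Sum>(i, j)\<in>index_pairs DIM('e). g (L i j) * g (L i j))"
  proof (rule sum_index_pairs)
    show "g (L j i) * g (L j i) = g (L i j) * g (L i j)" if "i \<in> {1..DIM('e)}" "j \<in> {1..DIM('e)}" for i j
      using that R.M_antisym[of j i] by simp
  qed (simp add: R.M_refl)
  ultimately show ?thesis by simp
qed

lemma Z_summand: "(\<lambda>\<alpha>. c \<alpha> \<odot>\<^bsub>A\<^esub> HG (root_refl \<alpha>)) \<in> P \<rightarrow> carrier A"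
  using gs_A by (auto simp: gs_def A_simps)

lemma Z_closed: "ama_Z W P c x y \<in> carrier A"
  unfolding ama_Z_def by (rule A.finsum_closed[OF Z_summand])

lemma g_Z: "g (ama_Z W P c x y) = R.Z"
  unfolding ama_Z_def g.map_finsum[OF Z_summand] R.Z_def by (simp add: gs_def A_simps)

lemma incl_closed: "u \<in> carrier A \<Longrightarrow> ama_incl W P c x y u \<in> carrier AC"
  unfolding ama_incl_def AC_eq by (simp add: T.tensor_closed)

lemma embed_incl: "algebra_embed AC (ama_incl W P c x y u) = g u"
  by (simp add: ama_incl_def g_def)

lemma dirac_square:
  defines "D \<equiv> ama_dirac W P c x y"
    and "M2 \<equiv> ama_incl W P c x y (ama_M2 W P c x y)"
    and "Z \<equiv> ama_incl W P c x y (ama_Z W P c x y)"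
  shows "D \<otimes>\<^bsub>AC\<^esub> D = (\<ominus>\<^bsub>AC\<^esub> M2) \<oplus>\<^bsub>AC\<^esub> (of_nat DIM('e) - 2) \<odot>\<^bsub>AC\<^esub> D \<oplus>\<^bsub>AC\<^esub> anticommutator AC D Z"
proof -
  have cl: "D \<in> carrier AC" "M2 \<in> carrier AC" "Z \<in> carrier AC"
    unfolding D_def M2_def Z_def by (simp_all add: dirac_closed incl_closed M2_closed Z_closed)
  \<comment> \<open>The embedding respects real scalars only, so n - 2 is displayed as the image of
    the real coefficient of \<open>R.D_square\<close>.\<close>
  have r: "(of_nat DIM('e) - 2 :: complex) = of_real (real (card {1..DIM('e)}) - 2)" by simp
  show ?thesis
  proof (rule algebra_embed_inj[OF E.complex_algebra_axioms])
    show "algebra_embed AC (D \<otimes>\<^bsub>AC\<^esub> D) = algebra_embed AC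
      ((\<ominus>\<^bsub>AC\<^esub> M2) \<oplus>\<^bsub>AC\<^esub> (of_nat DIM('e) - 2) \<odot>\<^bsub>AC\<^esub> D \<oplus>\<^bsub>AC\<^esub> anticommutator AC D Z)"
      unfolding r anticommutator_def
      using R.D_square cl
      by (simp only: E.map_add E.map_mult E.map_neg E.map_smult E.add.m_closed E.m_closed E.a_inv_closed E.smult_closed)
        (simp add: D_def M2_def Z_def embed_dirac embed_incl g_M2 g_Z)
  qed (use cl in \<open>simp_all add: anticommutator_def\<close>)
qed

end

theorem theorem3p5:
  fixes W :: "('e::euclidean_space \<Rightarrow> 'e) set"
    and R P :: "'e dual set"
    and c :: "'e dual \<Rightarrow> complex"
    and x :: "nat \<Rightarrow> 'e dual"
    and y :: "nat \<Rightarrow> 'e"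
  assumes "reflection_group W R"
    and "positive_system R P"
    and "invariant_param W P c"
    and "\<And>i j. i \<in> {1..DIM('e)} \<Longrightarrow> j \<in> {1..DIM('e)} \<Longrightarrow> y i \<bullet> y j = (if i = j then 1 else 0)"
    and "\<And>i j. i \<in> {1..DIM('e)} \<Longrightarrow> j \<in> {1..DIM('e)} \<Longrightarrow>
           blinfun_apply (x i) (y j) = (if i = j then 1 else 0)"
  shows "let AC = ama_cliff W P c x y;
             D = ama_dirac W P c x y;
             M2 = ama_incl W P c x y (ama_M2 W P c x y);
             Z = ama_incl W P c x y (ama_Z W P c x y)
         in D \<otimes>\<^bsub>AC\<^esub> D =
            (\<ominus>\<^bsub>AC\<^esub> M2) \<oplus>\<^bsub>AC\<^esub> (of_nat DIM('e) - 2) \<odot>\<^bsub>AC\<^esub> D \<oplus>\<^bsub>AC\<^esub> anticommutator AC D Z"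
proof -
  have W: "W = generate orthogonal_group (root_refl ` R)" and R: "finite R" "0 \<notin> R"
    using assms(1) by (auto simp: reflection_group_def root_system_def)
  have P: "P \<subseteq> R" using assms(2) by (auto simp: positive_system_def)
  interpret O: group "orthogonal_group :: ('e \<Rightarrow> 'e) monoid" by (rule group_orthogonal_group)
  have gen: "root_refl ` R \<subseteq> carrier orthogonal_group"
    by (auto simp: orthogonal_group_def orthogonal_root_refl)
  \<comment> \<open>The properties of \<open>W\<close> come from its being generated inside the
    orthogonal group, those of \<open>P\<close> from its inclusion in the root system.\<close>
  interpret dunkl_angular_momentum W P c x y
  proof
    show "id \<in> W"
      using generate.one[of orthogonal_group "root_refl ` R"] by (simp add: W orthogonal_group_def)
    show "v \<circ> w \<in> W" if "v \<in> W" "w \<in> W" for v w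
      using generate.eng[of v orthogonal_group "root_refl ` R" w] that
      unfolding W[symmetric] by (simp add: orthogonal_group_def)
    show "orthogonal_transformation w" if "w \<in> W" for w
      using O.generate_in_carrier[OF gen, of w] that unfolding W[symmetric] by (simp add: orthogonal_group_def)
    show "finite P" using P R finite_subset by blast
    show "root_refl \<alpha> \<in> W" if "\<alpha> \<in> P" for \<alpha>
      unfolding W by (rule generate.incl) (use that P in auto)
    show "\<alpha> \<noteq> 0" if "\<alpha> \<in> P" for \<alpha> using that P R by auto
  qed (use assms(4,5) in auto)
  show ?thesis unfolding Let_def by (rule dirac_square)
qed

end
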